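(* Let $f:\mathbb{R}^d\to\mathbb{R}$ be convex, differentiable, $L$-smooth, and minimized at $x_*\in\mathbb{R}^d$. Let $(x_t,z_t)_{t\ge 0}$ be the continuized Nesterov acceleration, i.e. the càdlàg process with initial values $x_0,z_0\in\mathbb{R}^d$ satisfying $$\mathrm{d}x_t=\eta_t(z_t-x_t)\,\mathrm{d}t-\gamma_t\nabla f(x_t)\,\mathrm{d}N(t),\qquad \mathrm{d}z_t=\eta'_t(x_t-z_t)\,\mathrm{d}t-\gamma'_t\nabla f(x_t)\,\mathrm{d}N(t),$$ where $\mathrm{d}N(t)=\sum_{k\ge1}\delta_{T_k}(\mathrm{d}t)$ is a Poisson point measure on $\mathbb{R}_{\ge0}$ of intensity $\mathrm{d}t$. Then: 1. For the parameters $\eta_t=\frac2t$, $\eta'_t=0$, $\gamma_t=\frac1L$, $\gamma'_t=\frac{t}{2L}$, $$\mathbb{E}f(x_t)-f(x_* )\le\frac{2L\|z_0-x_*\|^2}{t^2}.$$ 2. Assume further that $f$ is $\mu$-strongly convex with $\mu>0$. For the constant parameters $\eta_t=\eta'_t\equiv\sqrt{\frac{\mu}{L}}$, $\gamma_t\equiv\frac1L$, $\gamma'_t\equiv\frac1{\sqrt{\mu L}}$, $$\mathbb{E}f(x_t)-f(x_* )\le\Big(f(x_0)-f(x_* )+\frac\mu2\|z_0-x_*\|^2\Big)\exp\Big(-\sqrt{\frac\mu L}\,t\Big).$$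
   Context: $L$-smooth means $f(y)\le f(x)+\langle\nabla f(x),y-x\rangle+\frac L2\|y-x\|^2$ for all $x,y$; $\mu$-strongly convex means $f(y)\ge f(x)+\langle\nabla f(x),y-x\rangle+\frac\mu2\|y-x\|^2$ for all $x,y$. The random times $0<T_1<T_2<\dots$ are such that $T_1,T_2-T_1,T_3-T_2,\dots$ are i.i.d. exponential of rate $1$. The stochastic equation means: the processes are càdlàg (right continuous with left limits); at each $T_k$, $x_{T_k}=x_{T_k-}-\gamma_{T_k}\nabla f(x_{T_k-})$ and $z_{T_k}=z_{T_k-}-\gamma'_{T_k}\nabla f(x_{T_k-})$, where $x_{t-},z_{t-}$ denote left limits; between these times, $(x_t,z_t)$ follows the linear ODE $\mathrm{d}x_t=\eta_t(z_t-x_t)\,\mathrm{d}t$, $\mathrm{d}z_t=\eta'_t(x_t-z_t)\,\mathrm{d}t$. The expectation $\mathbb{E}$ is with respect to the Poisson point process, the only source of randomness. *)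

theory Defs
  imports "HOL-Probability.Probability"
begin

definition gradient :: "('v::real_inner \<Rightarrow> real) \<Rightarrow> 'v \<Rightarrow> 'v"
  where "gradient f x = (THE D. GDERIV f x :> D)"

lemma GDERIV_unique:
  assumes "GDERIV f x :> D" "GDERIV f x :> D'"
  shows "D = D'"
proof -
  have "(\<lambda>h. h \<bullet> D) = (\<lambda>h. h \<bullet> D')"
    by (rule has_derivative_unique[OF assms[unfolded gderiv_def]])
  from fun_cong[OF this, of "D - D'"] have "(D - D') \<bullet> (D - D') = 0"
    by (simp only: inner_diff_right diff_self)
  then show ?thesis
    by (simp only: inner_eq_zero_iff right_minus_eq)
qed

lemma GDERIV_gradient:
  fixes f :: "'v::euclidean_space \<Rightarrow> real"
  assumes "f differentiable (at x)"
  shows "GDERIV f x :> gradient f x"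
proof -
  obtain f' where f': "(f has_derivative f') (at x)"
    using assms unfolding differentiable_def by blast
  then have lin: "linear f'"
    by (rule has_derivative_linear)
  define D where "D = (\<Sum>b\<in>Basis. f' b *\<^sub>R b)"
  have "f' h = h \<bullet> D" for h
  proof -
    have "f' h = f' (\<Sum>b\<in>Basis. (h \<bullet> b) *\<^sub>R b)"
      by (simp only: euclidean_representation)
    also have "\<dots> = (\<Sum>b\<in>Basis. (h \<bullet> b) * f' b)"
      by (simp only: linear_sum[OF lin] linear_scale[OF lin] real_scaleR_def)
    also have "\<dots> = h \<bullet> D"
      by (simp only: D_def inner_sum_right inner_scaleR_right mult.commute)
    finally show ?thesis .
  qed
  then have "f' = (\<lambda>h. h \<bullet> D)"
    by (rule ext)
  with f' have D: "GDERIV f x :> D"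
    unfolding gderiv_def by simp
  then have "gradient f x = D"
    unfolding gradient_def by (rule the_equality) (rule GDERIV_unique[OF _ D])
  with D show ?thesis
    by simp
qed

definition L_smooth :: "real \<Rightarrow> ('v::real_inner \<Rightarrow> real) \<Rightarrow> bool"
  where "L_smooth L f \<longleftrightarrow>
    (\<forall>x y. f y \<le> f x + gradient f x \<bullet> (y - x) + L / 2 * (norm (y - x))\<^sup>2)"

definition strongly_convex :: "real \<Rightarrow> ('v::real_inner \<Rightarrow> real) \<Rightarrow> bool"
  where "strongly_convex \<mu> f \<longleftrightarrow>
    (\<forall>x y. f y \<ge> f x + gradient f x \<bullet> (y - x) + \<mu> / 2 * (norm (y - x))\<^sup>2)"

(* The random times are T 1, T 2, ...; the entry T 0 is not a random time but the constant 0,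
   so that T 1 is the first increment. That 0 < T 1 < T 2 < ... almost surely follows from the
   law of the increments. *)
definition poisson_times :: "'w measure \<Rightarrow> (nat \<Rightarrow> 'w \<Rightarrow> real) \<Rightarrow> bool"
  where "poisson_times M T \<longleftrightarrow>
    (\<forall>\<omega>\<in>space M. T 0 \<omega> = 0) \<and>
    prob_space.indep_vars M (\<lambda>_. borel) (\<lambda>k \<omega>. T (Suc k) \<omega> - T k \<omega>) UNIV \<and>
    (\<forall>k. distributed M lborel (\<lambda>\<omega>. T (Suc k) \<omega> - T k \<omega>) (exponential_density 1))"

definition cadlag :: "(real \<Rightarrow> 'v::topological_space) \<Rightarrow> bool"
  where "cadlag u \<longleftrightarrow>
    (\<forall>t\<ge>0. (u \<longlongrightarrow> u t) (at_right t)) \<and> (\<forall>t>0. \<exists>l. (u \<longlongrightarrow> l) (at_left t))"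

abbreviation left_lim :: "(real \<Rightarrow> 'v::t2_space) \<Rightarrow> real \<Rightarrow> 'v"
  where "left_lim u t \<equiv> Lim (at_left t) u"

(* A single path, driven by the deterministic jump times \<tau> 1 < \<tau> 2 < ... (\<tau> 0 = 0 is not a
   jump time). The ODE is required at positive times only, so that a coefficient which is singular
   at time 0, such as 2 / t, is admissible; the initial value enters through right continuity at 0. *)
definition continuized_path ::
  "('v::euclidean_space \<Rightarrow> real) \<Rightarrow> (real \<Rightarrow> real) \<Rightarrow> (real \<Rightarrow> real) \<Rightarrow> (real \<Rightarrow> real) \<Rightarrow>
    (real \<Rightarrow> real) \<Rightarrow> 'v \<Rightarrow> 'v \<Rightarrow> (nat \<Rightarrow> real) \<Rightarrow> (real \<Rightarrow> 'v) \<Rightarrow> (real \<Rightarrow> 'v) \<Rightarrow> bool"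
  where "continuized_path f \<eta> \<eta>' \<gamma> \<gamma>' x0 z0 \<tau> x z \<longleftrightarrow>
    cadlag x \<and> cadlag z \<and> x 0 = x0 \<and> z 0 = z0 \<and>
    (\<forall>k\<ge>1.
      x (\<tau> k) = left_lim x (\<tau> k) - \<gamma> (\<tau> k) *\<^sub>R gradient f (left_lim x (\<tau> k)) \<and>
      z (\<tau> k) = left_lim z (\<tau> k) - \<gamma>' (\<tau> k) *\<^sub>R gradient f (left_lim x (\<tau> k))) \<and>
    (\<forall>t>0. t \<notin> \<tau> ` {1..} \<longrightarrow>
      (x has_vector_derivative \<eta> t *\<^sub>R (z t - x t)) (at t) \<and>
      (z has_vector_derivative \<eta>' t *\<^sub>R (x t - z t)) (at t))"

(* The processes are families of random variables indexed by t \<ge> 0, whose paths almost surely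
   solve the equation; the values at t < 0 are irrelevant. *)
definition continuized_nesterov ::
  "'w measure \<Rightarrow> (nat \<Rightarrow> 'w \<Rightarrow> real) \<Rightarrow> ('v::euclidean_space \<Rightarrow> real) \<Rightarrow> (real \<Rightarrow> real) \<Rightarrow>
    (real \<Rightarrow> real) \<Rightarrow> (real \<Rightarrow> real) \<Rightarrow> (real \<Rightarrow> real) \<Rightarrow> 'v \<Rightarrow> 'v \<Rightarrow>
    (real \<Rightarrow> 'w \<Rightarrow> 'v) \<Rightarrow> (real \<Rightarrow> 'w \<Rightarrow> 'v) \<Rightarrow> bool"
  where "continuized_nesterov M T f \<eta> \<eta>' \<gamma> \<gamma>' x0 z0 x z \<longleftrightarrow>
    (\<forall>t\<ge>0. x t \<in> borel_measurable M \<and> z t \<in> borel_measurable M) \<and>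
    (AE \<omega> in M. continuized_path f \<eta> \<eta>' \<gamma> \<gamma>' x0 z0
      (\<lambda>k. T k \<omega>) (\<lambda>t. x t \<omega>) (\<lambda>t. z t \<omega>))"

end

theory Submission
  imports Defs "HOL-Real_Asymp.Real_Asymp"
begin

text \<open>
  Let \<open>\<phi>\<close> be the Lyapunov function, \<open>t\<^sup>2 (f x - f x\<^sub>*) + 2 L |z - x\<^sub>*|\<^sup>2\<close> in the convex case and
  \<open>exp (a t) (f x - f x\<^sub>* + \<mu>/2 |z - x\<^sub>*|\<^sup>2)\<close> with \<open>a = sqrt (\<mu> / L)\<close> in the strongly convex case.
  Along the ODE, the derivative of \<open>\<phi>\<close> plus the increment that a jump would cause is at most \<open>0\<close>.
  No stochastic calculus is needed to conclude \<open>E \<phi>\<^sub>t \<le> \<phi>\<^sub>0\<close>: between two jumps the path is an explicit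
  flow, and given the past the waiting time \<open>u\<close> has density \<open>exp (- u)\<close>. Integrating
  \<open>- d/du (exp (- u) \<phi>)\<close>, which dominates \<open>exp (- u)\<close> times the value of \<open>\<phi>\<close> after a jump, gives
  \<open>a\<^bsub>k+1\<^esub> + b\<^sub>k \<le> a\<^sub>k\<close>, where \<open>a\<^sub>k\<close> is the expectation of \<open>\<phi>\<close> right after the \<open>k\<close>-th jump restricted to
  the event that this jump happens up to time \<open>t\<close>, and \<open>b\<^sub>k\<close> that of \<open>\<phi>\<^sub>t\<close> restricted to the event of
  exactly \<open>k\<close> jumps up to \<open>t\<close>. Almost surely only finitely many jumps happen up to \<open>t\<close>, so
  \<open>E \<phi>\<^sub>t\<close> is the sum of the \<open>b\<^sub>k\<close>, hence at most \<open>a\<^sub>0 = \<phi>\<^sub>0\<close>.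
\<close>

section \<open>Waiting times and the states after the jumps\<close>

text \<open>With \<open>a = t - s\<close> this is the probability that no jump occurs between
  \<open>s\<close> and \<open>t\<close>.\<close>

lemma nn_integral_exp_tail:
  fixes a :: real
  shows "(\<integral>\<^sup>+u. ennreal (exp (- u)) * indicator {a..} u \<partial>lborel) = ennreal (exp (- a))"
proof -
  have "((\<lambda>u::real. - exp (- u)) \<longlongrightarrow> - 0) at_top"
    by (intro tendsto_minus filterlim_compose[OF exp_at_bot] filterlim_uminus_at_bot_at_top)
  then have "(\<integral>\<^sup>+u. ennreal (exp (- u)) * indicator {a..} u \<partial>lborel) = ennreal (0 - (- exp (- a)))"
    by (intro nn_integral_FTC_atLeast) (auto intro!: derivative_eq_intros)
  then show ?thesis by simp
qed

text \<open>A deterministic functional of the jump times: it serves for a fixed path and, applied to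
  partial sums of gaps, as a measurable function of the past.\<close>

primrec post_jump :: "(real \<Rightarrow> real \<Rightarrow> 's \<Rightarrow> 's) \<Rightarrow> (real \<Rightarrow> 's \<Rightarrow> 's) \<Rightarrow> 's \<Rightarrow> (nat \<Rightarrow> real) \<Rightarrow> nat \<Rightarrow> 's"
  where
    "post_jump flow J y0 \<tau> 0 = y0"
  | "post_jump flow J y0 \<tau> (Suc k) = J (\<tau> (Suc k)) (flow (\<tau> k) (\<tau> (Suc k)) (post_jump flow J y0 \<tau> k))"

lemma post_jump_cong:
  assumes "\<And>i. i \<le> k \<Longrightarrow> \<tau> i = \<tau>' i"
  shows "post_jump flow J y0 \<tau> k = post_jump flow J y0 \<tau>' k"
  using assms by (induction k) simp_all

subsection \<open>Poisson arrivals\<close>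

locale exponential_gaps = prob_space M for M :: "'w measure" +
  fixes D :: "nat \<Rightarrow> 'w \<Rightarrow> real"
  assumes indep_gaps: "indep_vars (\<lambda>_. borel) D UNIV"
    and gap_distributed: "distributed M lborel (D k) (exponential_density 1)"
begin

lemma measurable_gap [measurable]: "D k \<in> borel_measurable M"
  using distributed_measurable[OF gap_distributed[of k]] by simp

definition arrival :: "nat \<Rightarrow> 'w \<Rightarrow> real"
  where "arrival k \<omega> = (\<Sum>i<k. D i \<omega>)"

lemma arrival_0 [simp]: "arrival 0 \<omega> = 0"
  by (simp add: arrival_def)

lemma arrival_Suc: "arrival (Suc k) \<omega> = arrival k \<omega> + D k \<omega>"
  by (simp add: arrival_def)

lemma measurable_arrival [measurable]: "arrival k \<in> borel_measurable M"
  unfolding arrival_def[abs_def] by measurable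

lemma AE_gap_pos: "AE \<omega> in M. 0 < D k \<omega>"
proof -
  \<comment> \<open>The density equals \<open>1\<close> at \<open>0\<close>, so the null set
    \<open>{0}\<close> is discarded to get strict positivity.\<close>
  have "AE u in lborel. 0 < ennreal (exponential_density 1 u) \<longrightarrow> 0 < (u::real)"
    using AE_lborel_singleton[of 0] by eventually_elim (auto simp: exponential_density_def)
  then have "AE u in distr M lborel (D k). 0 < u"
    unfolding distributed_distr_eq_density[OF gap_distributed[of k]]
    by (subst AE_density) auto
  then show ?thesis
    by (subst (asm) AE_distr_iff) auto
qed

lemma AE_arrival_strict_mono: "AE \<omega> in M. strict_mono (\<lambda>k. arrival k \<omega>)"
proof -
  have "AE \<omega> in M. \<forall>k. 0 < D k \<omega>"
    using AE_gap_pos by (simp add: AE_all_countable)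
  then show ?thesis
    by eventually_elim (auto simp: strict_mono_Suc_iff arrival_Suc)
qed

lemma AE_arrival_nonneg: "AE \<omega> in M. 0 \<le> arrival k \<omega>"
  using AE_arrival_strict_mono
  by eventually_elim (metis arrival_0 le0 strict_mono_less_eq)

text \<open>\<open>D k\<close> is independent of the earlier gaps, so Fubini integrates it out with
  its exponential law while any statistic \<open>G\<close> of the past stays fixed. This takes the
  place of conditioning on the past.\<close>

lemma nn_integral_past_gap:
  assumes G[measurable]: "G \<in> measurable (PiM {..<k} (\<lambda>_. borel)) N"
    and h[measurable]: "case_prod h \<in> borel_measurable (N \<Otimes>\<^sub>M borel)"
  shows "(\<integral>\<^sup>+\<omega>. h (G (\<lambda>i\<in>{..<k}. D i \<omega>)) (D k \<omega>) \<partial>M) =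
    (\<integral>\<^sup>+\<omega>. (\<integral>\<^sup>+u. ennreal (exponential_density 1 u) * h (G (\<lambda>i\<in>{..<k}. D i \<omega>)) u \<partial>lborel) \<partial>M)"
proof -
  let ?P = "PiM {..<k} (\<lambda>_. borel :: real measure)" and ?Q = "PiM {k} (\<lambda>_. borel :: real measure)"
  define W where "W \<omega> = (\<lambda>i\<in>{..<k}. D i \<omega>)" for \<omega>
  define V where "V \<omega> = (\<lambda>i\<in>{k}. D i \<omega>)" for \<omega>
  have "indep_var ?P W ?Q V"
    unfolding W_def[abs_def] V_def[abs_def] by (rule indep_var_restrict[OF indep_gaps]) auto
  then have W[measurable]: "W \<in> measurable M ?P" and [measurable]: "V \<in> measurable M ?Q"
    and eq: "distr M ?P W \<Otimes>\<^sub>M distr M ?Q V = distr M (?P \<Otimes>\<^sub>M ?Q) (\<lambda>\<omega>. (W \<omega>, V \<omega>))"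
    by (auto simp: indep_var_distribution_eq)
  have [measurable]: "(\<lambda>v. v k) \<in> borel_measurable ?Q"
    by (rule measurable_component_singleton) simp
  interpret V: prob_space "distr M ?Q V" by (rule prob_space_distr) simp
  have "(\<integral>\<^sup>+\<omega>. h (G (W \<omega>)) (D k \<omega>) \<partial>M) =
      (\<integral>\<^sup>+p. h (G (fst p)) (snd p k) \<partial>distr M (?P \<Otimes>\<^sub>M ?Q) (\<lambda>\<omega>. (W \<omega>, V \<omega>)))"
    by (subst nn_integral_distr) (auto simp: V_def)
  also have "\<dots> = (\<integral>\<^sup>+w. \<integral>\<^sup>+v. h (G w) (v k) \<partial>distr M ?Q V \<partial>distr M ?P W)"
    unfolding eq[symmetric] by (subst V.nn_integral_fst[symmetric]) auto
  also have "\<dots> = (\<integral>\<^sup>+\<omega>. \<integral>\<^sup>+v. h (G (W \<omega>)) (v k) \<partial>distr M ?Q V \<partial>M)"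
    by (subst nn_integral_distr) auto
  also have "\<dots> = (\<integral>\<^sup>+\<omega>. (\<integral>\<^sup>+u. ennreal (exponential_density 1 u) * h (G (W \<omega>)) u \<partial>lborel) \<partial>M)"
  proof (rule nn_integral_cong)
    fix \<omega> assume "\<omega> \<in> space M"
    then have [measurable]: "G (W \<omega>) \<in> space N"
      by (rule measurable_space[OF measurable_compose[OF W G]])
    have "(\<integral>\<^sup>+v. h (G (W \<omega>)) (v k) \<partial>distr M ?Q V) = (\<integral>\<^sup>+\<omega>'. h (G (W \<omega>)) (D k \<omega>') \<partial>M)"
      by (subst nn_integral_distr) (auto simp: V_def)
    also have "\<dots> = (\<integral>\<^sup>+u. ennreal (exponential_density 1 u) * h (G (W \<omega>)) u \<partial>lborel)"
      by (rule distributed_nn_integral[OF gap_distributed, symmetric]) simp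
    finally show "(\<integral>\<^sup>+v. h (G (W \<omega>)) (v k) \<partial>distr M ?Q V) =
        (\<integral>\<^sup>+u. ennreal (exponential_density 1 u) * h (G (W \<omega>)) u \<partial>lborel)" .
  qed
  finally show ?thesis by (simp add: W_def)
qed

text \<open>The Laplace transform of the arrival time at \<open>1\<close>: each independent gap
  contributes a factor \<open>1 / 2\<close>. It serves to rule out explosion.\<close>

lemma nn_integral_exp_arrival: "(\<integral>\<^sup>+\<omega>. ennreal (exp (- arrival n \<omega>)) \<partial>M) = ennreal ((1 / 2) ^ n)"
proof (induction n)
  case 0
  then show ?case by (simp add: emeasure_space_1)
next
  case (Suc n)
  have half: "(\<integral>\<^sup>+u. ennreal (exponential_density 1 u) * ennreal (exp (- u)) \<partial>lborel) = ennreal (1 / 2)"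
  proof -
    have "((\<lambda>u::real. - exp (- 2 * u) / 2) \<longlongrightarrow> 0) at_top"
      by real_asymp
    then have "(\<integral>\<^sup>+u. ennreal (exp (- 2 * u)) * indicator {0..} u \<partial>lborel) = ennreal (0 - (- exp (- 2 * 0) / 2))"
      by (intro nn_integral_FTC_atLeast) (auto intro!: derivative_eq_intros)
    moreover have "(\<integral>\<^sup>+u. ennreal (exponential_density 1 u) * ennreal (exp (- u)) \<partial>lborel) =
        (\<integral>\<^sup>+u. ennreal (exp (- 2 * u)) * indicator {0..} u \<partial>lborel)"
      by (intro nn_integral_cong)
        (auto simp: exponential_density_def indicator_def simp flip: ennreal_mult exp_add)
    ultimately show ?thesis by simp
  qed
  have "(\<integral>\<^sup>+\<omega>. ennreal (exp (- arrival (Suc n) \<omega>)) \<partial>M) =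
      (\<integral>\<^sup>+\<omega>. (\<integral>\<^sup>+u. ennreal (exponential_density 1 u) * ennreal (exp (- (arrival n \<omega> + u))) \<partial>lborel) \<partial>M)"
    using nn_integral_past_gap[of "\<lambda>d. \<Sum>i<n. d i" n borel "\<lambda>s u. ennreal (exp (- (s + u)))"]
    by (simp add: arrival_def)
  also have "\<dots> = (\<integral>\<^sup>+\<omega>. ennreal (exp (- arrival n \<omega>)) * (\<integral>\<^sup>+u. ennreal (exponential_density 1 u) * ennreal (exp (- u)) \<partial>lborel) \<partial>M)"
    by (intro nn_integral_cong, subst nn_integral_cmult[symmetric])
      (auto intro!: nn_integral_cong simp: exp_add[of "- _" "- _", simplified] ennreal_mult mult_ac)
  also have "\<dots> = ennreal ((1 / 2) ^ n) * ennreal (1 / 2)"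
    unfolding half by (subst nn_integral_multc) (auto simp: Suc)
  also have "\<dots> = ennreal ((1 / 2) ^ Suc n)"
    by (subst ennreal_mult[symmetric]) (auto simp: mult.commute)
  finally show ?case .
qed

text \<open>Non-explosion by a Chernoff bound: on the event \<open>A\<close> that no arrival exceeds
  \<open>t\<close>, \<open>exp (- arrival n \<omega>)\<close> is at least \<open>exp (- t)\<close>,
  so \<open>exp (- t)\<close> times the probability of \<open>A\<close> is at most
  \<open>(1 / 2) ^ n\<close> for every \<open>n\<close>.\<close>

lemma AE_arrival_exceeds: "AE \<omega> in M. \<exists>n. t < arrival n \<omega>"
proof -
  define A where "A = {\<omega> \<in> space M. \<forall>n. arrival n \<omega> \<le> t}"
  have A[measurable]: "A \<in> sets M" unfolding A_def by measurable
  have bound: "ennreal (exp (- t)) * emeasure M A \<le> ennreal ((1 / 2) ^ n)" for n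
  proof -
    have "ennreal (exp (- t)) * emeasure M A = (\<integral>\<^sup>+\<omega>. ennreal (exp (- t)) * indicator A \<omega> \<partial>M)"
      by (simp add: nn_integral_cmult)
    also have "\<dots> \<le> (\<integral>\<^sup>+\<omega>. ennreal (exp (- arrival n \<omega>)) \<partial>M)"
      by (intro nn_integral_mono) (auto simp: A_def indicator_def intro!: ennreal_leI)
    finally show ?thesis by (simp add: nn_integral_exp_arrival)
  qed
  have "(\<lambda>n. ennreal ((1 / 2) ^ n)) \<longlonglongrightarrow> ennreal 0"
    by (intro tendsto_ennrealI LIMSEQ_realpow_zero) auto
  then have "ennreal (exp (- t)) * emeasure M A \<le> ennreal 0"
    by (rule LIMSEQ_le_const) (use bound in blast)
  then have "emeasure M A = 0" by simp
  then have "AE \<omega> in M. \<omega> \<notin> A"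
    by (intro AE_not_in) (auto simp: null_sets_def)
  then show ?thesis
    by (rule AE_mp) (auto simp: A_def not_le)
qed

end

subsection \<open>Expected decrease of a Lyapunov function\<close>

text \<open>\<open>dissipation\<close> is the one-gap statement started from state \<open>y\<close>
  at time \<open>s\<close>: the integral covers a next jump up to \<open>t\<close>, the other term
  no jump up to \<open>t\<close>. With \<phi> in \<open>ennreal\<close>, integrability need not be
  discussed.\<close>

locale jump_flow = exponential_gaps M D for M :: "'w measure" and D +
  fixes flow :: "real \<Rightarrow> real \<Rightarrow> 's::topological_space \<Rightarrow> 's" and J :: "real \<Rightarrow> 's \<Rightarrow> 's"
    and \<phi> :: "real \<Rightarrow> 's \<Rightarrow> ennreal" and y0 :: 's
  assumes measurable_flow: "(\<lambda>(s, t, y). flow s t y) \<in> borel_measurable (borel \<Otimes>\<^sub>M borel \<Otimes>\<^sub>M borel)"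
    and measurable_J: "(\<lambda>(t, y). J t y) \<in> borel_measurable (borel \<Otimes>\<^sub>M borel)"
    and measurable_\<phi>: "(\<lambda>(t, y). \<phi> t y) \<in> borel_measurable (borel \<Otimes>\<^sub>M borel)"
    and dissipation: "0 \<le> s \<Longrightarrow> s \<le> t \<Longrightarrow>
      (\<integral>\<^sup>+u. ennreal (exp (- u)) * \<phi> (s + u) (J (s + u) (flow s (s + u) y)) * indicator {0..t - s} u \<partial>lborel) +
        ennreal (exp (- (t - s))) * \<phi> t (flow s t y) \<le> \<phi> s y"
begin

lemma measurable_flow' [measurable (raw)]:
  assumes [measurable]: "a \<in> borel_measurable N" "b \<in> borel_measurable N" "c \<in> borel_measurable N"
  shows "(\<lambda>w. flow (a w) (b w) (c w)) \<in> borel_measurable N"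
  using measurable_compose[OF _ measurable_flow, of "\<lambda>w. (a w, b w, c w)" N] by simp

lemma measurable_J' [measurable (raw)]:
  assumes [measurable]: "a \<in> borel_measurable N" "c \<in> borel_measurable N"
  shows "(\<lambda>w. J (a w) (c w)) \<in> borel_measurable N"
  using measurable_compose[OF _ measurable_J, of "\<lambda>w. (a w, c w)" N] by simp

lemma measurable_\<phi>' [measurable (raw)]:
  assumes [measurable]: "a \<in> borel_measurable N" "c \<in> borel_measurable N"
  shows "(\<lambda>w. \<phi> (a w) (c w)) \<in> borel_measurable N"
  using measurable_compose[OF _ measurable_\<phi>, of "\<lambda>w. (a w, c w)" N] by simp

definition Y :: "nat \<Rightarrow> 'w \<Rightarrow> 's"
  where "Y k \<omega> = post_jump flow J y0 (\<lambda>i. arrival i \<omega>) k"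

lemma Y_0: "Y 0 \<omega> = y0"
  by (simp add: Y_def)

lemma Y_Suc: "Y (Suc k) \<omega> = J (arrival (Suc k) \<omega>) (flow (arrival k \<omega>) (arrival (Suc k) \<omega>) (Y k \<omega>))"
  by (simp add: Y_def)

lemma measurable_Y [measurable]: "Y k \<in> borel_measurable M"
proof (induction k)
  case 0
  then show ?case by (simp add: Y_0[abs_def])
next
  case (Suc k)
  note [measurable] = Suc
  show ?case unfolding Y_Suc[abs_def] by measurable
qed

text \<open>\<open>arrival k\<close> and \<open>Y k\<close> are measurable functions of the gaps
  with index below \<open>k\<close>, so \<open>nn_integral_past_gap\<close> applies with this pair
  as the statistic.\<close>

lemma nn_integral_Y_gap:
  assumes "case_prod h \<in> borel_measurable ((borel \<Otimes>\<^sub>M borel) \<Otimes>\<^sub>M borel)"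
  shows "(\<integral>\<^sup>+\<omega>. h (arrival k \<omega>, Y k \<omega>) (D k \<omega>) \<partial>M) =
    (\<integral>\<^sup>+\<omega>. (\<integral>\<^sup>+u. ennreal (exponential_density 1 u) * h (arrival k \<omega>, Y k \<omega>) u \<partial>lborel) \<partial>M)"
proof -
  define \<tau> :: "(nat \<Rightarrow> real) \<Rightarrow> nat \<Rightarrow> real" where "\<tau> = (\<lambda>d j. \<Sum>i<j. d i)"
  have \<tau>: "(\<lambda>d. \<tau> d j) \<in> borel_measurable (PiM {..<k} (\<lambda>_. borel))" if "j \<le> k" for j
    unfolding \<tau>_def using that by (intro borel_measurable_sum measurable_component_singleton) auto
  \<comment> \<open>The induction index \<open>j\<close> runs up to the fixed \<open>k\<close>, so
    that the domain \<open>PiM {..<k}\<close> stays the same throughout.\<close>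
  have "(\<lambda>d. post_jump flow J y0 (\<tau> d) j) \<in> borel_measurable (PiM {..<k} (\<lambda>_. borel))" if "j \<le> k" for j
    using that
  proof (induction j)
    case 0
    then show ?case by simp
  next
    case (Suc j)
    have [measurable]: "(\<lambda>d. \<tau> d j) \<in> borel_measurable (PiM {..<k} (\<lambda>_. borel))"
      "(\<lambda>d. \<tau> d (Suc j)) \<in> borel_measurable (PiM {..<k} (\<lambda>_. borel))"
      "(\<lambda>d. post_jump flow J y0 (\<tau> d) j) \<in> borel_measurable (PiM {..<k} (\<lambda>_. borel))"
      using Suc by (auto intro: \<tau>)
    show ?case by simp
  qed
  then have "(\<lambda>d. (\<tau> d k, post_jump flow J y0 (\<tau> d) k)) \<in> PiM {..<k} (\<lambda>_. borel) \<rightarrow>\<^sub>M borel \<Otimes>\<^sub>M borel"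
    using \<tau> by (intro measurable_Pair) auto
  note nn_integral_past_gap[OF this assms]
  moreover have *: "\<tau> (\<lambda>i\<in>{..<k}. D i \<omega>) j = arrival j \<omega>" if "j \<le> k" for j \<omega>
    unfolding \<tau>_def arrival_def using that by (intro sum.cong) auto
  moreover have "post_jump flow J y0 (\<tau> (\<lambda>i\<in>{..<k}. D i \<omega>)) k = Y k \<omega>" for \<omega>
    unfolding Y_def by (rule post_jump_cong) (rule *)
  ultimately show ?thesis by simp
qed

text \<open>Integrates \<open>dissipation\<close> against the law of the state after the
  \<open>k\<close>-th jump.\<close>

lemma expected_gap_step:
  "(\<integral>\<^sup>+\<omega>. \<phi> (arrival (Suc k) \<omega>) (Y (Suc k) \<omega>) * indicator {..t} (arrival (Suc k) \<omega>) \<partial>M) +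
    (\<integral>\<^sup>+\<omega>. \<phi> t (flow (arrival k \<omega>) t (Y k \<omega>)) * indicator {arrival k \<omega>..<arrival (Suc k) \<omega>} t \<partial>M)
    \<le> (\<integral>\<^sup>+\<omega>. \<phi> (arrival k \<omega>) (Y k \<omega>) * indicator {..t} (arrival k \<omega>) \<partial>M)"
    (is "?a + ?b \<le> ?c")
proof -
  \<comment> \<open>The integrand as a function of the state \<open>(s, y)\<close> and the gap
    \<open>u\<close>: a jump at \<open>s + u\<close> up to \<open>t\<close>, or survival past
    \<open>t\<close>. The conditional states survival as a measurable predicate of \<open>s\<close>
    and \<open>u\<close>.\<close>
  define h where "h = (\<lambda>(s, y) u. \<phi> (s + u) (J (s + u) (flow s (s + u) y)) * indicator {..t} (s + u) +
    \<phi> t (flow s t y) * (if s \<le> t \<and> t < s + u then 1 else 0))"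
  have [measurable]: "case_prod h \<in> borel_measurable ((borel \<Otimes>\<^sub>M borel) \<Otimes>\<^sub>M borel)"
    unfolding h_def split_beta' by measurable
  have inner: "(\<integral>\<^sup>+u. ennreal (exponential_density 1 u) * h (s, y) u \<partial>lborel) \<le> \<phi> s y * indicator {..t} s"
    if "0 \<le> s" for s y
  proof (cases "s \<le> t")
    case True
    \<comment> \<open>Only an inequality, because \<open>{0..t - s}\<close> and
      \<open>{t - s..}\<close> share the point \<open>t - s\<close>.\<close>
    have "(\<integral>\<^sup>+u. ennreal (exponential_density 1 u) * h (s, y) u \<partial>lborel) \<le>
      (\<integral>\<^sup>+u. ennreal (exp (- u)) * \<phi> (s + u) (J (s + u) (flow s (s + u) y)) * indicator {0..t - s} u +
        \<phi> t (flow s t y) * (ennreal (exp (- u)) * indicator {t - s..} u) \<partial>lborel)"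
      using True
      by (intro nn_integral_mono)
        (auto simp: h_def exponential_density_def indicator_def distrib_left mult_ac)
    also have "\<dots> = (\<integral>\<^sup>+u. ennreal (exp (- u)) * \<phi> (s + u) (J (s + u) (flow s (s + u) y)) * indicator {0..t - s} u \<partial>lborel) +
        \<phi> t (flow s t y) * ennreal (exp (- (t - s)))"
      by (simp add: nn_integral_add nn_integral_cmult nn_integral_exp_tail)
    also have "\<dots> \<le> \<phi> s y"
      using dissipation[OF that True, of y] by (simp add: mult.commute)
    finally show ?thesis using True by simp
  next
    case False
    then have "ennreal (exponential_density 1 u) * h (s, y) u = 0" for u
      by (auto simp: h_def exponential_density_def indicator_def)
    then show ?thesis by (simp only: nn_integral_const mult_zero_left zero_le)
  qed
  have "?a + ?b = (\<integral>\<^sup>+\<omega>. \<phi> (arrival (Suc k) \<omega>) (Y (Suc k) \<omega>) * indicator {..t} (arrival (Suc k) \<omega>) +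
      \<phi> t (flow (arrival k \<omega>) t (Y k \<omega>)) * (if arrival k \<omega> \<le> t \<and> t < arrival (Suc k) \<omega> then 1 else 0) \<partial>M)"
    by (subst nn_integral_add) (auto simp: indicator_def intro!: arg_cong2[where f="(+)"] nn_integral_cong)
  also have "\<dots> = (\<integral>\<^sup>+\<omega>. h (arrival k \<omega>, Y k \<omega>) (D k \<omega>) \<partial>M)"
    by (simp add: h_def arrival_Suc Y_Suc)
  also have "\<dots> = (\<integral>\<^sup>+\<omega>. (\<integral>\<^sup>+u. ennreal (exponential_density 1 u) * h (arrival k \<omega>, Y k \<omega>) u \<partial>lborel) \<partial>M)"
    by (rule nn_integral_Y_gap) measurable
  also have "\<dots> \<le> ?c"
    using AE_arrival_nonneg[of k] by (intro nn_integral_mono_AE) (auto intro: inner)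
  finally show ?thesis .
qed

text \<open>Telescoping of \<open>expected_gap_step\<close>. The remainder after \<open>n\<close>
  jumps is kept so that the induction closes.\<close>

lemma expected_partial_sum:
  assumes "0 \<le> t"
  shows "(\<Sum>k<n. \<integral>\<^sup>+\<omega>. \<phi> t (flow (arrival k \<omega>) t (Y k \<omega>)) * indicator {arrival k \<omega>..<arrival (Suc k) \<omega>} t \<partial>M) +
    (\<integral>\<^sup>+\<omega>. \<phi> (arrival n \<omega>) (Y n \<omega>) * indicator {..t} (arrival n \<omega>) \<partial>M) \<le> \<phi> 0 y0"
proof (induction n)
  case 0
  then show ?case using assms by (simp add: Y_0 emeasure_space_1)
next
  case (Suc n)
  show ?case
    by (rule order_trans[OF _ Suc]) (use expected_gap_step[of n t] in \<open>simp add: add_ac add_left_mono\<close>)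
qed

text \<open>Almost surely \<open>t\<close> lies between two consecutive arrivals, so the value at
  \<open>t\<close> is one summand of the series of the \<open>b k\<close>, whose partial sums have
  expectation at most \<open>\<phi> 0 y0\<close>.\<close>

theorem expected_lyapunov_le:
  assumes "0 \<le> t"
    and w: "AE \<omega> in M. \<forall>k. arrival k \<omega> \<le> t \<and> t < arrival (Suc k) \<omega> \<longrightarrow> w \<omega> = flow (arrival k \<omega>) t (Y k \<omega>)"
  shows "(\<integral>\<^sup>+\<omega>. \<phi> t (w \<omega>) \<partial>M) \<le> \<phi> 0 y0"
proof -
  define b where "b k \<omega> = \<phi> t (flow (arrival k \<omega>) t (Y k \<omega>)) * indicator {arrival k \<omega>..<arrival (Suc k) \<omega>} t" for k \<omega>
  have [measurable]: "b k \<in> borel_measurable M" for k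
  proof -
    have "b k = (\<lambda>\<omega>. \<phi> t (flow (arrival k \<omega>) t (Y k \<omega>)) * (if arrival k \<omega> \<le> t \<and> t < arrival (Suc k) \<omega> then 1 else 0))"
      by (auto simp: b_def indicator_def)
    then show ?thesis by simp
  qed
  have "AE \<omega> in M. \<phi> t (w \<omega>) \<le> (\<Sum>k. b k \<omega>)"
    using w AE_arrival_exceeds[of t]
  proof eventually_elim
    case (elim \<omega>)
    \<comment> \<open>\<open>m\<close> is not \<open>0\<close> since
      \<open>arrival 0 \<omega> = 0\<close> is at most \<open>t\<close>; its predecessor
      \<open>k\<close> indexes the last arrival up to \<open>t\<close>.\<close>
    define m where "m = (LEAST n. t < arrival n \<omega>)"
    have m: "t < arrival m \<omega>"
      unfolding m_def using elim(2) by (rule LeastI_ex)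
    then obtain k where k: "m = Suc k"
      using assms(1) by (cases m) auto
    then have "arrival k \<omega> \<le> t"
      unfolding m_def by (metis lessI not_le not_less_Least)
    then have "\<phi> t (w \<omega>) = b k \<omega>"
      using m k elim(1) by (simp add: b_def)
    also have "\<dots> \<le> (\<Sum>k. b k \<omega>)"
      using sum_le_suminf[of "\<lambda>k. b k \<omega>" "{k}"] by simp
    finally show ?case .
  qed
  then have "(\<integral>\<^sup>+\<omega>. \<phi> t (w \<omega>) \<partial>M) \<le> (\<integral>\<^sup>+\<omega>. (\<Sum>k. b k \<omega>) \<partial>M)"
    by (rule nn_integral_mono_AE)
  also have "\<dots> = (\<Sum>k. \<integral>\<^sup>+\<omega>. b k \<omega> \<partial>M)"
    by (rule nn_integral_suminf) measurable
  also have "\<dots> \<le> \<phi> 0 y0"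
  proof (rule suminf_le_const)
    show "(\<Sum>k<n. \<integral>\<^sup>+\<omega>. b k \<omega> \<partial>M) \<le> \<phi> 0 y0" for n
      using expected_partial_sum[OF assms(1), of n] unfolding b_def
      by (rule order_trans[rotated]) simp
  qed simp
  finally show ?thesis .
qed

end

text \<open>Here \<open>g\<close> is the Lyapunov function along the flow and \<psi> its value after
  a jump. The hypothesis bounds \<open>exp (- u) * \<psi> (s + u)\<close> by the derivative
  \<open>F'\<close> of \<open>F\<close>, and the endpoint value \<open>F (t - s)\<close> cancels the
  survival term.\<close>

lemma dissipation_of_generator_inequality:
  fixes g g' \<psi> :: "real \<Rightarrow> real"
  assumes "s \<le> t"
    and g: "\<And>u. s \<le> u \<Longrightarrow> u \<le> t \<Longrightarrow> (g has_real_derivative g' u) (at u)"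
    and [measurable]: "g \<in> borel_measurable borel" "g' \<in> borel_measurable borel"
    and \<psi>: "\<And>u. s \<le> u \<Longrightarrow> u \<le> t \<Longrightarrow> 0 \<le> \<psi> u" "\<And>u. s \<le> u \<Longrightarrow> u \<le> t \<Longrightarrow> g' u + (\<psi> u - g u) \<le> 0"
    and "0 \<le> g t"
  shows "(\<integral>\<^sup>+u. ennreal (exp (- u)) * ennreal (\<psi> (s + u)) * indicator {0..t - s} u \<partial>lborel) +
    ennreal (exp (- (t - s))) * ennreal (g t) \<le> ennreal (g s)"
proof -
  define F where "F u = - exp (- u) * g (s + u)" for u
  define F' where "F' u = exp (- u) * (g (s + u) - g' (s + u))" for u
  have [measurable]: "F' \<in> borel_measurable borel"
    unfolding F'_def by measurable
  have F: "(F has_real_derivative F' u) (at u)" if "u \<in> {0..t - s}" for u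
  proof -
    have "((\<lambda>u. g (s + u)) has_real_derivative g' (s + u) * 1) (at u)"
      by (rule DERIV_chain2[where f = g]) (use that in \<open>auto intro!: g derivative_eq_intros\<close>)
    then show ?thesis
      unfolding F_def F'_def by (auto intro!: derivative_eq_intros simp: algebra_simps)
  qed
  have le: "exp (- u) * \<psi> (s + u) \<le> F' u" if "u \<in> {0..t - s}" for u
    unfolding F'_def using \<psi>(2)[of "s + u"] that by (intro mult_left_mono) auto
  have nn: "0 \<le> F' u" if "u \<in> {0..t - s}" for u
    using that by (intro order_trans[OF _ le[OF that]] mult_nonneg_nonneg \<psi>(1)) auto
  have "(\<integral>\<^sup>+u. ennreal (exp (- u)) * ennreal (\<psi> (s + u)) * indicator {0..t - s} u \<partial>lborel) \<le>
      (\<integral>\<^sup>+u. ennreal (F' u) * indicator {0..t - s} u \<partial>lborel)"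
    using le \<psi>(1)
    by (intro nn_integral_mono) (auto simp: indicator_def simp flip: ennreal_mult intro!: ennreal_leI)
  also have "\<dots> = ennreal (F (t - s) - F 0)"
    using assms(1) F nn by (intro nn_integral_FTC_Icc) auto
  finally have "(\<integral>\<^sup>+u. ennreal (exp (- u)) * ennreal (\<psi> (s + u)) * indicator {0..t - s} u \<partial>lborel) +
      ennreal (exp (- (t - s))) * ennreal (g t) \<le> ennreal (F (t - s) - F 0) + ennreal (exp (- (t - s)) * g t)"
    using assms(7) by (simp add: ennreal_mult add_right_mono)
  also have "\<dots> = ennreal (g s)"
  proof -
    \<comment> \<open>Monotonicity makes the difference nonnegative, so that addition in
      \<open>ennreal\<close> agrees with real addition.\<close>
    have "F 0 \<le> F (t - s)"
      using F nn assms(1) by (intro DERIV_nonneg_imp_nondecreasing[of 0 "t - s" F]) force+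
    then show ?thesis
      using assms(7) by (subst ennreal_plus[symmetric]) (auto simp: F_def)
  qed
  finally show ?thesis .
qed

subsection \<open>Gradients\<close>

lemma gradient_derivative:
  fixes f :: "'v::euclidean_space \<Rightarrow> real"
  assumes "f differentiable (at (p u))" "(p has_vector_derivative p') (at u)"
  shows "((\<lambda>u. f (p u)) has_real_derivative gradient f (p u) \<bullet> p') (at u)"
proof -
  have "(f has_derivative (\<lambda>h. h \<bullet> gradient f (p u))) (at (p u))"
    using GDERIV_gradient[OF assms(1)] by (simp add: gderiv_def)
  from has_derivative_compose[OF assms(2)[unfolded has_vector_derivative_def] this]
  show ?thesis
    by (simp add: has_field_derivative_def inner_commute mult_commute_abs)
qed

text \<open>Each coordinate is a pointwise limit of difference quotients of the continuous function
  \<open>f\<close>, with steps \<open>1 / (n + 1)\<close>.\<close>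

lemma borel_measurable_gradient:
  fixes f :: "'v::euclidean_space \<Rightarrow> real"
  assumes "\<forall>x. f differentiable (at x)"
  shows "gradient f \<in> borel_measurable borel"
proof (subst borel_measurable_euclidean_space, rule ballI)
  fix b :: 'v assume "b \<in> Basis"
  have "continuous_on UNIV f"
    using assms by (simp add: differentiable_imp_continuous_on differentiable_on_def differentiable_at_withinI)
  then have [measurable]: "f \<in> borel_measurable borel"
    by (rule borel_measurable_continuous_onI)
  show "(\<lambda>x. gradient f x \<bullet> b) \<in> borel_measurable borel"
  proof (rule borel_measurable_LIMSEQ_real)
    fix x :: 'v
    have "((\<lambda>h. x + h *\<^sub>R b) has_vector_derivative b) (at 0)"
      by (auto intro!: derivative_eq_intros)
    from gradient_derivative[of f "\<lambda>h. x + h *\<^sub>R b", OF _ this]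
    have "((\<lambda>h. f (x + h *\<^sub>R b)) has_real_derivative gradient f x \<bullet> b) (at 0)"
      using assms by simp
    then have "((\<lambda>h. (f (x + h *\<^sub>R b) - f x) / h) \<longlongrightarrow> gradient f x \<bullet> b) (at 0)"
      by (simp add: DERIV_def)
    moreover have "filterlim (\<lambda>n. inverse (real (Suc n))) (at 0) sequentially"
      by (rule filterlim_atI[OF LIMSEQ_inverse_real_of_nat]) auto
    ultimately show "(\<lambda>n. (f (x + inverse (real (Suc n)) *\<^sub>R b) - f x) / inverse (real (Suc n))) \<longlonglongrightarrow> gradient f x \<bullet> b"
      by (rule filterlim_compose)
  qed measurable
qed

text \<open>The restriction of \<open>f\<close> to the line through \<open>x\<close> and
  \<open>y\<close> is convex in one variable, and its tangent at \<open>0\<close> lies below it at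
  \<open>1\<close>.\<close>

lemma convex_on_gradient_le:
  fixes f :: "'v::euclidean_space \<Rightarrow> real"
  assumes "convex_on UNIV f" "f differentiable (at x)"
  shows "f x + gradient f x \<bullet> (y - x) \<le> f y"
proof -
  define p where "p u = x + u *\<^sub>R (y - x)" for u :: real
  have p: "p ((1 - u) * a + u * b) = (1 - u) *\<^sub>R p a + u *\<^sub>R p b" for u a b
    by (simp add: p_def algebra_simps)
  have "convex_on UNIV (f \<circ> p)"
    using assms(1) by (auto intro!: convex_onI simp: p convex_onD)
  moreover have "(f \<circ> p has_real_derivative gradient f (p 0) \<bullet> (y - x)) (at 0)"
    unfolding o_def
    by (rule gradient_derivative) (use assms(2) in \<open>auto simp: p_def intro!: derivative_eq_intros\<close>)
  ultimately have "(f \<circ> p) 1 - (f \<circ> p) 0 \<ge> gradient f (p 0) \<bullet> (y - x) * (1 - 0)"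
    by (intro convex_on_imp_above_tangent[where A = UNIV]) (auto simp del: o_apply)
  then show ?thesis by (simp add: p_def)
qed

text \<open>In the quadratic upper bound the linear term gives \<open>- |g|^2 / L\<close> and the
  quadratic one \<open>|g|^2 / (2 L)\<close>, where \<open>g\<close> is the gradient at
  \<open>x\<close>.\<close>

lemma L_smooth_gradient_step:
  assumes "L_smooth L f" "L > 0"
  shows "f (x - (1 / L) *\<^sub>R gradient f x) \<le> f x - (norm (gradient f x))\<^sup>2 / (2 * L)"
proof -
  have "f (x - (1 / L) *\<^sub>R gradient f x) \<le>
      f x + gradient f x \<bullet> (x - (1 / L) *\<^sub>R gradient f x - x) + L / 2 * (norm (x - (1 / L) *\<^sub>R gradient f x - x))\<^sup>2"
    using assms(1) unfolding L_smooth_def by blast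
  also have "\<dots> = f x - (norm (gradient f x))\<^sup>2 / (2 * L)"
    using assms(2) by (simp add: power_divide power2_norm_eq_inner[symmetric] field_simps power2_eq_square)
  finally show ?thesis .
qed

subsection \<open>Paths of the continuized process\<close>

text \<open>Applied to the conserved quantities of the ODE. At \<open>s\<close> only right
  continuity is asked for, which is what a path offers at a jump time and at time
  \<open>0\<close>.\<close>

lemma constant_on_interval:
  fixes F :: "real \<Rightarrow> 'v::banach"
  assumes "s < t" "(F \<longlongrightarrow> F s) (at_right s)"
    and F: "\<And>u. s < u \<Longrightarrow> u \<le> t \<Longrightarrow> (F has_vector_derivative 0) (at u)"
  shows "F t = F s"
proof (rule has_derivative_zero_unique_strong_convex[of "{s..t}" "{s}" F s "F s" t])
  show "continuous_on {s..t} F"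
    unfolding continuous_on_def
  proof
    fix u assume u: "u \<in> {s..t}"
    show "(F \<longlongrightarrow> F u) (at u within {s..t})"
    proof (cases "u = s")
      case True
      then show ?thesis
        using assms(1,2) by (simp add: at_within_Icc_at_right)
    next
      case False
      then show ?thesis
        using u F[of u] by (auto dest!: has_vector_derivative_continuous simp: isCont_def intro: tendsto_within_subset)
    qed
  qed
  fix u assume "u \<in> {s..t} - {s}"
  then show "(F has_derivative (\<lambda>h. 0)) (at u within {s..t})"
    using F[of u] by (auto simp: has_vector_derivative_def intro: has_derivative_at_withinI)
qed (use assms in auto)

text \<open>
  The flow is not required to be the identity for \<open>s = t = 0\<close>: with \<open>\<eta>\<^sub>t = 2 / t\<close> right continuity at
  \<open>0\<close> forces \<open>x\<^sub>t = z\<^sub>0\<close> until the first jump, and so \<open>x\<^sub>0 = z\<^sub>0\<close>.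
\<close>

definition is_flow :: "(real \<Rightarrow> real) \<Rightarrow> (real \<Rightarrow> real) \<Rightarrow> (real \<Rightarrow> real \<Rightarrow> 'v \<times> 'v \<Rightarrow> 'v \<times> 'v::euclidean_space) \<Rightarrow> bool"
  where "is_flow \<eta> \<eta>' flow \<longleftrightarrow>
    (\<forall>s t x z. 0 \<le> s \<longrightarrow> s < t \<longrightarrow> (x \<longlongrightarrow> x s) (at_right s) \<longrightarrow> (z \<longlongrightarrow> z s) (at_right s) \<longrightarrow>
      (\<forall>u. s < u \<longrightarrow> u \<le> t \<longrightarrow> (x has_vector_derivative \<eta> u *\<^sub>R (z u - x u)) (at u) \<and>
        (z has_vector_derivative \<eta>' u *\<^sub>R (x u - z u)) (at u)) \<longrightarrow>
      (x t, z t) = flow s t (x s, z s)) \<and>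
    (\<forall>s t y. 0 \<le> s \<longrightarrow> s < t \<longrightarrow> isCont (\<lambda>u. flow s u y) t) \<and>
    (\<forall>s y. 0 < s \<longrightarrow> flow s s y = y)"

definition jump :: "('v::real_inner \<Rightarrow> real) \<Rightarrow> (real \<Rightarrow> real) \<Rightarrow> (real \<Rightarrow> real) \<Rightarrow> real \<Rightarrow> 'v \<times> 'v \<Rightarrow> 'v \<times> 'v"
  where "jump f \<gamma> \<gamma>' t y =
    (fst y - \<gamma> t *\<^sub>R gradient f (fst y), snd y - \<gamma>' t *\<^sub>R gradient f (fst y))"

text \<open>Induction over the jumps: between them the flow property applies, and at a jump the left
  limit of the path is the flow continued to the jump time. So the path becomes an explicit function
  of the jump times.\<close>

lemma continuized_path_eq_flow:
  assumes path: "continuized_path f \<eta> \<eta>' \<gamma> \<gamma>' x0 z0 \<tau> x z"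
    and flow: "is_flow \<eta> \<eta>' flow"
    and \<tau>: "strict_mono \<tau>" "\<tau> 0 = 0"
  defines "Y \<equiv> post_jump flow (jump f \<gamma> \<gamma>') (x0, z0) \<tau>"
  shows continuized_path_post_jump: "(x (\<tau> k), z (\<tau> k)) = Y k"
    and continuized_path_between_jumps:
      "\<tau> k < t \<Longrightarrow> t < \<tau> (Suc k) \<Longrightarrow> (x t, z t) = flow (\<tau> k) t (Y k)"
proof -
  have nonneg: "0 \<le> \<tau> k" for k
    using strict_mono_less_eq[OF \<tau>(1), of 0 k] \<tau>(2) by simp
  have right: "(x \<longlongrightarrow> x t) (at_right t)" "(z \<longlongrightarrow> z t) (at_right t)" if "0 \<le> t" for t
    using path that by (auto simp: continuized_path_def cadlag_def)
  have between: "(x t, z t) = flow (\<tau> k) t (x (\<tau> k), z (\<tau> k))" if t: "\<tau> k < t" "t < \<tau> (Suc k)" for k t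
  proof -
    have "u \<notin> \<tau> ` {1..}" if u: "\<tau> k < u" "u \<le> t" for u
    proof
      assume "u \<in> \<tau> ` {1..}"
      then obtain i where i: "u = \<tau> i" by auto
      with u t have "\<tau> k < \<tau> i" "\<tau> i < \<tau> (Suc k)" by auto
      then show False using \<tau>(1) by (simp add: strict_mono_less)
    qed
    then have "\<forall>u. \<tau> k < u \<longrightarrow> u \<le> t \<longrightarrow> (x has_vector_derivative \<eta> u *\<^sub>R (z u - x u)) (at u) \<and>
        (z has_vector_derivative \<eta>' u *\<^sub>R (x u - z u)) (at u)"
      using path nonneg[of k] by (auto simp: continuized_path_def)
    then show ?thesis
      using flow t(1) right[OF nonneg] nonneg unfolding is_flow_def by blast
  qed
  show post: "(x (\<tau> k), z (\<tau> k)) = Y k" for k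
  proof (induction k)
    case 0
    then show ?case using path \<tau>(2) by (simp add: Y_def continuized_path_def)
  next
    case (Suc k)
    define e where "e = \<tau> (Suc k)"
    define y where "y = flow (\<tau> k) e (Y k)"
    have lt: "\<tau> k < e" using \<tau>(1) by (simp add: e_def strict_mono_less)
    \<comment> \<open>The path follows the flow only before \<open>e\<close>; continuity of the flow
      in its end time identifies the left limit there.\<close>
    have "((\<lambda>u. flow (\<tau> k) u (Y k)) \<longlongrightarrow> y) (at_left e)"
    proof -
      have "isCont (\<lambda>u. flow (\<tau> k) u (Y k)) e"
        using flow lt nonneg[of k] unfolding is_flow_def by blast
      then show ?thesis
        unfolding isCont_def y_def by (rule tendsto_within_subset) simp
    qed
    moreover have "eventually (\<lambda>u. flow (\<tau> k) u (Y k) = (x u, z u)) (at_left e)"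
      using eventually_at_left_real[OF lt] by eventually_elim (use between[of k] Suc in \<open>auto simp: e_def\<close>)
    ultimately have lim: "((\<lambda>u. (x u, z u)) \<longlongrightarrow> y) (at_left e)"
      by (blast intro: Lim_transform_eventually)
    have "left_lim x e = fst y" "left_lim z e = snd y"
      using tendsto_fst[OF lim] tendsto_snd[OF lim] by (auto intro!: tendsto_Lim)
    moreover have "x e = left_lim x e - \<gamma> e *\<^sub>R gradient f (left_lim x e) \<and>
        z e = left_lim z e - \<gamma>' e *\<^sub>R gradient f (left_lim x e)"
      using path by (simp add: continuized_path_def e_def)
    ultimately have "(x e, z e) = jump f \<gamma> \<gamma>' e y"
      by (simp add: jump_def)
    then show ?case by (simp add: Y_def y_def e_def)
  qed
  show "(x t, z t) = flow (\<tau> k) t (Y k)" if "\<tau> k < t" "t < \<tau> (Suc k)"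
    using between[OF that] by (simp add: post)
qed

section \<open>From the random equation to the expected Lyapunov bound\<close>

lemma poisson_times_arrival:
  assumes "prob_space M" "poisson_times M T"
  defines "D \<equiv> \<lambda>k \<omega>. T (Suc k) \<omega> - T k \<omega>"
  shows "exponential_gaps M D"
    and "\<omega> \<in> space M \<Longrightarrow> exponential_gaps.arrival D k \<omega> = T k \<omega>"
proof -
  show *: "exponential_gaps M D"
    using assms(2) by (auto simp: exponential_gaps_def exponential_gaps_axioms_def poisson_times_def D_def assms(1))
  show "exponential_gaps.arrival D k \<omega> = T k \<omega>" if "\<omega> \<in> space M"
    using assms(2) that
    unfolding exponential_gaps.arrival_def[OF *]
    by (simp add: D_def sum_lessThan_telescope[of "\<lambda>k. T k \<omega>"] poisson_times_def)
qed

text \<open>Reduces each parameter choice to an explicit flow, the derivative \<open>\<phi>'\<close>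
  of \<phi> along it, and the generator inequality. \<open>start\<close> asks only that \<phi> be
  unchanged by the flow at equal times, since with the singular coefficient the flow at time
  \<open>0\<close> need not be the identity; accordingly \<open>time\<close> admits
  \<open>t = 0\<close> only if the flow fixes the initial state.\<close>

lemma continuized_nesterov_expected_lyapunov_le:
  fixes f :: "'v::euclidean_space \<Rightarrow> real"
  assumes M: "prob_space M" "poisson_times M T"
    and diff: "\<forall>x. f differentiable (at x)"
    and nesterov: "continuized_nesterov M T f \<eta> \<eta>' \<gamma> \<gamma>' x0 z0 x z"
    and flow: "is_flow \<eta> \<eta>' flow" "(\<lambda>(s, t, y). flow s t y) \<in> borel_measurable borel"
    and [measurable]: "\<gamma> \<in> borel_measurable borel" "\<gamma>' \<in> borel_measurable borel"
    and \<phi>: "(\<lambda>(t, y). \<phi> t y) \<in> borel_measurable borel" "\<And>t y. 0 \<le> t \<Longrightarrow> 0 \<le> \<phi> t y"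
    and \<phi>': "(\<lambda>(s, t, y). \<phi>' s t y) \<in> borel_measurable borel"
      "\<And>s t y. 0 < t \<or> 0 \<le> t \<and> s = 0 \<Longrightarrow> ((\<lambda>t. \<phi> t (flow s t y)) has_real_derivative \<phi>' s t y) (at t)"
    and generator: "\<And>s t y. 0 \<le> s \<Longrightarrow> s \<le> t \<Longrightarrow>
      \<phi>' s t y + (\<phi> t (jump f \<gamma> \<gamma>' t (flow s t y)) - \<phi> t (flow s t y)) \<le> 0"
    and start: "\<And>s y. 0 \<le> s \<Longrightarrow> \<phi> s (flow s s y) = \<phi> s y"
    and time: "0 < t \<or> t = 0 \<and> flow 0 0 (x0, z0) = (x0, z0)"
  shows "(\<integral>\<^sup>+\<omega>. ennreal (\<phi> t (x t \<omega>, z t \<omega>)) \<partial>M) \<le> ennreal (\<phi> 0 (x0, z0))"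
proof -
  define D where "D = (\<lambda>k \<omega>. T (Suc k) \<omega> - T k \<omega>)"
  interpret exponential_gaps M D
    unfolding D_def using M by (rule poisson_times_arrival)
  have arrival: "arrival k \<omega> = T k \<omega>" if "\<omega> \<in> space M" for k \<omega>
    using poisson_times_arrival(2)[OF M that] by (simp add: D_def)
  note [measurable] = borel_measurable_gradient[OF diff]
  have flow_meas: "(\<lambda>(s, t, y). flow s t y) \<in> borel_measurable (borel \<Otimes>\<^sub>M borel \<Otimes>\<^sub>M borel)"
    using flow(2) by (simp add: borel_prod)
  have \<phi>_meas: "(\<lambda>(t, y). \<phi> t y) \<in> borel_measurable (borel \<Otimes>\<^sub>M borel)"
    using \<phi>(1) by (simp add: borel_prod)
  have \<phi>'_meas: "(\<lambda>(s, t, y). \<phi>' s t y) \<in> borel_measurable (borel \<Otimes>\<^sub>M borel \<Otimes>\<^sub>M borel)"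
    using \<phi>'(1) by (simp add: borel_prod)
  interpret jump_flow M D flow "jump f \<gamma> \<gamma>'" "\<lambda>t y. ennreal (\<phi> t y)" "(x0, z0)"
  proof
    show "(\<lambda>(t, y). jump f \<gamma> \<gamma>' t y) \<in> borel_measurable (borel \<Otimes>\<^sub>M borel)"
      unfolding jump_def borel_prod[symmetric] by measurable
    show "(\<lambda>(t, y). ennreal (\<phi> t y)) \<in> borel_measurable (borel \<Otimes>\<^sub>M borel)"
      using measurable_compose[OF \<phi>_meas measurable_ennreal] by (simp add: case_prod_unfold)
    fix s t :: real and y :: "'v \<times> 'v"
    assume st: "0 \<le> s" "s \<le> t"
    have "(\<lambda>t. flow s t y) \<in> borel_measurable borel"
      using measurable_compose[OF _ flow_meas, of "\<lambda>t. (s, t, y)" borel] by simp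
    then have "(\<lambda>t. \<phi> t (flow s t y)) \<in> borel_measurable borel"
      using measurable_compose[OF _ \<phi>_meas, of "\<lambda>t. (t, flow s t y)" borel] by simp
    moreover have "(\<lambda>t. \<phi>' s t y) \<in> borel_measurable borel"
      using measurable_compose[OF _ \<phi>'_meas, of "\<lambda>t. (s, t, y)" borel] by simp
    ultimately have "(\<integral>\<^sup>+u. ennreal (exp (- u)) * ennreal (\<phi> (s + u) (jump f \<gamma> \<gamma>' (s + u) (flow s (s + u) y))) *
          indicator {0..t - s} u \<partial>lborel) + ennreal (exp (- (t - s))) * ennreal (\<phi> t (flow s t y))
        \<le> ennreal (\<phi> s (flow s s y))"
      using st
      by (intro dissipation_of_generator_inequality[where g' = "\<lambda>t. \<phi>' s t y" and
            \<psi> = "\<lambda>t. \<phi> t (jump f \<gamma> \<gamma>' t (flow s t y))" and g = "\<lambda>t. \<phi> t (flow s t y)"]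
          \<phi>(2) \<phi>'(2) generator) auto
    then show "(\<integral>\<^sup>+u. ennreal (exp (- u)) * ennreal (\<phi> (s + u) (jump f \<gamma> \<gamma>' (s + u) (flow s (s + u) y))) *
          indicator {0..t - s} u \<partial>lborel) + ennreal (exp (- (t - s))) * ennreal (\<phi> t (flow s t y))
        \<le> ennreal (\<phi> s y)"
      using start st(1) by simp
  qed (fact flow_meas)
  show ?thesis
  proof (rule expected_lyapunov_le)
    have "AE \<omega> in M. continuized_path f \<eta> \<eta>' \<gamma> \<gamma>' x0 z0 (\<lambda>k. T k \<omega>) (\<lambda>t. x t \<omega>) (\<lambda>t. z t \<omega>)"
      using nesterov by (simp add: continuized_nesterov_def)
    then show "AE \<omega> in M. \<forall>k. arrival k \<omega> \<le> t \<and> t < arrival (Suc k) \<omega> \<longrightarrow>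
        (x t \<omega>, z t \<omega>) = flow (arrival k \<omega>) t (Y k \<omega>)"
      using AE_arrival_strict_mono AE_space
    proof eventually_elim
      case (elim \<omega>)
      have path: "continuized_path f \<eta> \<eta>' \<gamma> \<gamma>' x0 z0 (\<lambda>k. arrival k \<omega>) (\<lambda>t. x t \<omega>) (\<lambda>t. z t \<omega>)"
        using elim(1) by (simp add: arrival[OF elim(3)])
      note eq = continuized_path_eq_flow[OF path flow(1) elim(2) arrival_0, folded Y_def]
      show ?case
      proof (intro allI impI, elim conjE)
        fix k assume k: "arrival k \<omega> \<le> t" "t < arrival (Suc k) \<omega>"
        show "(x t \<omega>, z t \<omega>) = flow (arrival k \<omega>) t (Y k \<omega>)"
        proof (cases "arrival k \<omega> = t")
          case False
          then show ?thesis using eq(2)[of k t] k by simp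
        next
          case True
          \<comment> \<open>Here \<open>t\<close> is itself an arrival. For positive
            \<open>t\<close> the flow at equal times is the identity; for \<open>t = 0\<close>
            strict monotonicity forces \<open>k = 0\<close>, and \<open>time\<close> covers the
            initial state.\<close>
          have "flow t t (Y k \<omega>) = Y k \<omega>"
          proof (cases "t = 0")
            case False
            then show ?thesis using time flow(1) unfolding is_flow_def by blast
          next
            case t0: True
            then have "arrival k \<omega> = arrival 0 \<omega>" using True by simp
            then have "k = 0" using strict_mono_eq[OF elim(2)] by blast
            then show ?thesis using time t0 by (simp add: Y_0)
          qed
          then show ?thesis using eq(1)[of k] True by simp
        qed
      qed
    qed
  qed (use time in auto)
qed

text \<open>As \<open>X - c\<close> is nonnegative, a finite integral of \<open>A * (X - c)\<close>
  already yields integrability; linearity then isolates the mean of \<open>X\<close>.\<close>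

lemma (in prob_space) integral_le_of_nn_integral_le:
  assumes [measurable]: "X \<in> borel_measurable M"
    and "\<And>\<omega>. c \<le> X \<omega>" "0 < A"
    and le: "(\<integral>\<^sup>+\<omega>. ennreal (A * (X \<omega> - c)) \<partial>M) \<le> ennreal B" and "0 \<le> B"
  shows "integrable M X \<and> (\<integral>\<omega>. X \<omega> \<partial>M) - c \<le> B / A"
proof -
  have nonneg: "AE \<omega> in M. 0 \<le> A * (X \<omega> - c)" using assms(2,3) by simp
  have "(\<integral>\<^sup>+\<omega>. ennreal (A * (X \<omega> - c)) \<partial>M) < \<infinity>"
    using le by (rule order.strict_trans1) simp
  then have "integrable M (\<lambda>\<omega>. A * (X \<omega> - c))"
    using nonneg by (intro integrableI_nonneg) auto
  then have int: "integrable M (\<lambda>\<omega>. X \<omega> - c)"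
    using assms(3) by simp
  then have "integrable M (\<lambda>\<omega>. (X \<omega> - c) + c)"
    by (intro Bochner_Integration.integrable_add) auto
  then have X: "integrable M X" by simp
  have "ennreal (\<integral>\<omega>. A * (X \<omega> - c) \<partial>M) \<le> ennreal B"
    using le int nonneg by (subst nn_integral_eq_integral[symmetric]) auto
  then have "A * ((\<integral>\<omega>. X \<omega> \<partial>M) - c) \<le> B"
    using X assms(5) by (simp add: prob_space ennreal_le_iff)
  with X assms(3) show ?thesis by (simp add: field_simps)
qed

lemma norm_diff_scaleR_square:
  fixes z g :: "'v::real_inner"
  shows "(norm (z - c *\<^sub>R g - p))\<^sup>2 = (norm (z - p))\<^sup>2 - 2 * c * (g \<bullet> (z - p)) + c\<^sup>2 * (norm g)\<^sup>2"
  unfolding power2_norm_eq_inner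
  by (simp add: inner_diff_left inner_diff_right inner_commute power2_eq_square[of c] right_diff_distrib)

subsection \<open>The two parameter choices\<close>

text \<open>From the conserved quantities \<open>t\<^sup>2 (x - z)\<close> and \<open>z\<close>. At \<open>s = t = 0\<close> the junk value \<open>0 / 0 = 0\<close>
  gives the correct right limit \<open>(z, z)\<close>.\<close>

definition convex_flow :: "real \<Rightarrow> real \<Rightarrow> 'v \<times> 'v \<Rightarrow> 'v \<times> 'v::euclidean_space"
  where "convex_flow s t y = (snd y + (s / t)\<^sup>2 *\<^sub>R (fst y - snd y), snd y)"

lemma is_flow_convex_flow: "is_flow (\<lambda>t. 2 / t) (\<lambda>t. 0) (convex_flow :: _ \<Rightarrow> _ \<Rightarrow> 'v \<times> 'v \<Rightarrow> 'v \<times> 'v::euclidean_space)"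
  unfolding is_flow_def
proof (intro conjI allI impI)
  fix s t :: real and x z :: "real \<Rightarrow> 'v"
  assume st: "0 \<le> s" "s < t"
    and right: "(x \<longlongrightarrow> x s) (at_right s)" "(z \<longlongrightarrow> z s) (at_right s)"
    and ode: "\<forall>u. s < u \<longrightarrow> u \<le> t \<longrightarrow> (x has_vector_derivative (2 / u) *\<^sub>R (z u - x u)) (at u) \<and>
        (z has_vector_derivative 0 *\<^sub>R (x u - z u)) (at u)"
  have z: "z t = z s"
    by (rule constant_on_interval) (use st right ode in auto)
  \<comment> \<open>The weight \<open>t\<^sup>2\<close> is the integrating factor of the drift
    \<open>2 / t\<close>; for \<open>s = 0\<close> the conserved value is \<open>0\<close>.\<close>
  have "t\<^sup>2 *\<^sub>R (x t - z t) = s\<^sup>2 *\<^sub>R (x s - z s)"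
  proof (rule constant_on_interval[OF st(2)])
    show "((\<lambda>u. u\<^sup>2 *\<^sub>R (x u - z u)) \<longlongrightarrow> s\<^sup>2 *\<^sub>R (x s - z s)) (at_right s)"
      by (intro tendsto_intros right)
    fix u assume u: "s < u" "u \<le> t"
    then have *: "(x has_vector_derivative (2 / u) *\<^sub>R (z u - x u)) (at u)" "(z has_vector_derivative 0) (at u)"
      using ode by auto
    have "((\<lambda>u. u\<^sup>2) has_real_derivative 2 * u) (at u)"
      by (auto intro!: derivative_eq_intros)
    from has_vector_derivative_scaleR[OF this has_vector_derivative_diff[OF *]]
    show "((\<lambda>u. u\<^sup>2 *\<^sub>R (x u - z u)) has_vector_derivative 0) (at u)"
      by (rule has_vector_derivative_eq_rhs)
        (use st u in \<open>simp add: power2_eq_square algebra_simps\<close>)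
  qed
  then have "(1 / t\<^sup>2) *\<^sub>R t\<^sup>2 *\<^sub>R (x t - z t) = (1 / t\<^sup>2) *\<^sub>R s\<^sup>2 *\<^sub>R (x s - z s)"
    by simp
  then show "(x t, z t) = convex_flow s t (x s, z s)"
    using st z by (simp add: convex_flow_def power_divide algebra_simps)
next
  fix s t :: real and y :: "'v \<times> 'v"
  assume "0 \<le> s" "s < t"
  then show "isCont (\<lambda>u. convex_flow s u y) t"
    unfolding convex_flow_def by (auto intro!: continuous_intros)
qed (simp add: convex_flow_def)

text \<open>For \<open>s = 0\<close> both components coincide, so the drift vanishes whatever the
  value of \<open>2 / t\<close>, the junk value at \<open>t = 0\<close> included.\<close>

lemma convex_flow_derivative:
  assumes "0 < t \<or> s = 0"
  shows "((\<lambda>t. fst (convex_flow s t y)) has_vector_derivative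
    (2 / t) *\<^sub>R (snd (convex_flow s t y) - fst (convex_flow s t y))) (at t)"
proof (cases "s = 0")
  case False
  then have t: "0 < t" using assms by simp
  have "((\<lambda>t. (s / t)\<^sup>2) has_real_derivative - (2 / t) * (s / t)\<^sup>2) (at t)"
    using t by (auto intro!: derivative_eq_intros simp: power2_eq_square field_simps)
  from has_vector_derivative_add[OF has_vector_derivative_const[of "snd y"]
      has_vector_derivative_scaleR[OF this has_vector_derivative_const[of "fst y - snd y"]]]
  show ?thesis
    unfolding convex_flow_def fst_conv snd_conv
    by (rule has_vector_derivative_eq_rhs) (rule euclidean_eqI, simp add: inner_simps algebra_simps)
qed (simp add: convex_flow_def)

text \<open>From the conserved quantities \<open>x + z\<close> and \<open>exp (2 a t) (x - z)\<close>.\<close>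

definition strong_flow :: "real \<Rightarrow> real \<Rightarrow> real \<Rightarrow> 'v \<times> 'v \<Rightarrow> 'v \<times> 'v::euclidean_space"
  where "strong_flow a s t y =
    ((1 / 2) *\<^sub>R ((fst y + snd y) + exp (- 2 * a * (t - s)) *\<^sub>R (fst y - snd y)),
     (1 / 2) *\<^sub>R ((fst y + snd y) - exp (- 2 * a * (t - s)) *\<^sub>R (fst y - snd y)))"

lemma is_flow_strong_flow:
  "is_flow (\<lambda>t. a) (\<lambda>t. a) (strong_flow a :: _ \<Rightarrow> _ \<Rightarrow> 'v \<times> 'v \<Rightarrow> 'v \<times> 'v::euclidean_space)"
  unfolding is_flow_def
proof (intro conjI allI impI)
  fix s t :: real and x z :: "real \<Rightarrow> 'v"
  assume st: "0 \<le> s" "s < t"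
    and right: "(x \<longlongrightarrow> x s) (at_right s)" "(z \<longlongrightarrow> z s) (at_right s)"
    and ode: "\<forall>u. s < u \<longrightarrow> u \<le> t \<longrightarrow> (x has_vector_derivative a *\<^sub>R (z u - x u)) (at u) \<and>
        (z has_vector_derivative a *\<^sub>R (x u - z u)) (at u)"
  have sum: "x t + z t = x s + z s"
  proof (rule constant_on_interval[OF st(2)])
    show "((\<lambda>u. x u + z u) \<longlongrightarrow> x s + z s) (at_right s)"
      by (intro tendsto_intros right)
    fix u assume "s < u" "u \<le> t"
    then have *: "(x has_vector_derivative a *\<^sub>R (z u - x u)) (at u)" "(z has_vector_derivative a *\<^sub>R (x u - z u)) (at u)"
      using ode by auto
    show "((\<lambda>u. x u + z u) has_vector_derivative 0) (at u)"
      by (rule has_vector_derivative_eq_rhs[OF has_vector_derivative_add[OF *]]) (simp add: algebra_simps)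
  qed
  have "exp (2 * a * (t - s)) *\<^sub>R (x t - z t) = exp (2 * a * (s - s)) *\<^sub>R (x s - z s)"
  proof (rule constant_on_interval[OF st(2)])
    show "((\<lambda>u. exp (2 * a * (u - s)) *\<^sub>R (x u - z u)) \<longlongrightarrow> exp (2 * a * (s - s)) *\<^sub>R (x s - z s)) (at_right s)"
      by (intro tendsto_intros right)
    fix u assume "s < u" "u \<le> t"
    then have *: "(x has_vector_derivative a *\<^sub>R (z u - x u)) (at u)" "(z has_vector_derivative a *\<^sub>R (x u - z u)) (at u)"
      using ode by auto
    have "((\<lambda>u. exp (2 * a * (u - s))) has_real_derivative 2 * a * exp (2 * a * (u - s))) (at u)"
      by (auto intro!: derivative_eq_intros)
    from has_vector_derivative_scaleR[OF this has_vector_derivative_diff[OF *]]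
    show "((\<lambda>u. exp (2 * a * (u - s)) *\<^sub>R (x u - z u)) has_vector_derivative 0) (at u)"
      by (rule has_vector_derivative_eq_rhs) (rule euclidean_eqI, simp add: inner_simps algebra_simps)
  qed
  then have "exp (- 2 * a * (t - s)) *\<^sub>R exp (2 * a * (t - s)) *\<^sub>R (x t - z t) = exp (- 2 * a * (t - s)) *\<^sub>R (x s - z s)"
    by simp
  then have diff: "x t - z t = exp (- 2 * a * (t - s)) *\<^sub>R (x s - z s)"
    by (simp add: flip: exp_add)
  have "x t = (1 / 2) *\<^sub>R ((x t + z t) + (x t - z t))" "z t = (1 / 2) *\<^sub>R ((x t + z t) - (x t - z t))"
    by (simp_all flip: scaleR_2)
  then show "(x t, z t) = strong_flow a s t (x s, z s)"
    unfolding strong_flow_def fst_conv snd_conv sum diff by simp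
next
  fix s t :: real and y :: "'v \<times> 'v"
  show "isCont (\<lambda>u. strong_flow a s u y) t"
    unfolding strong_flow_def by (auto intro!: continuous_intros)
next
  fix s and y :: "'v \<times> 'v"
  show "strong_flow a s s y = y"
    by (simp add: strong_flow_def flip: scaleR_2)
qed

lemma strong_flow_derivative:
  "((\<lambda>t. fst (strong_flow a s t y)) has_vector_derivative
    a *\<^sub>R (snd (strong_flow a s t y) - fst (strong_flow a s t y))) (at t)"
  "((\<lambda>t. snd (strong_flow a s t y)) has_vector_derivative
    a *\<^sub>R (fst (strong_flow a s t y) - snd (strong_flow a s t y))) (at t)"
proof -
  have e: "((\<lambda>t. exp (- 2 * a * (t - s))) has_real_derivative - 2 * a * exp (- 2 * a * (t - s))) (at t)"
    by (auto intro!: derivative_eq_intros)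
  note d = has_vector_derivative_scaleR[OF e has_vector_derivative_const[of "fst y - snd y"]]
  note half = bounded_linear.has_vector_derivative[OF bounded_linear_scaleR_right[of "1 / 2"]]
  show "((\<lambda>t. fst (strong_flow a s t y)) has_vector_derivative
      a *\<^sub>R (snd (strong_flow a s t y) - fst (strong_flow a s t y))) (at t)"
    unfolding strong_flow_def fst_conv snd_conv
    by (rule has_vector_derivative_eq_rhs[OF half[OF has_vector_derivative_add[OF has_vector_derivative_const d]]])
      (rule euclidean_eqI, simp add: inner_simps algebra_simps)
  show "((\<lambda>t. snd (strong_flow a s t y)) has_vector_derivative
      a *\<^sub>R (fst (strong_flow a s t y) - snd (strong_flow a s t y))) (at t)"
    unfolding strong_flow_def fst_conv snd_conv
    by (rule has_vector_derivative_eq_rhs[OF half[OF has_vector_derivative_diff[OF has_vector_derivative_const d]]])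
      (rule euclidean_eqI, simp add: inner_simps algebra_simps)
qed

section \<open>Generator inequalities for the two Lyapunov functions\<close>

text \<open>The drift gives \<open>2 t <g, z - x>\<close> and the jump of \<open>z\<close> gives
  \<open>- 2 t <g, z - p>\<close>, while the gradient step cancels the \<open>|g|^2\<close> term of
  that jump. What is left is at most \<open>2 t (f x - f p + <g, p - x>)\<close>, nonpositive by
  convexity.\<close>

lemma convex_generator_le:
  fixes f :: "'v::euclidean_space \<Rightarrow> real" and p x :: 'v
  assumes "convex_on UNIV f" "f differentiable (at x)" "L_smooth L f" "L > 0" "0 \<le> t"
  defines "g \<equiv> gradient f x"
  defines "\<phi> \<equiv> \<lambda>x z. t\<^sup>2 * (f x - f p) + 2 * L * (norm (z - p))\<^sup>2"
  shows "2 * t * (f x - f p) + t\<^sup>2 * (g \<bullet> ((2 / t) *\<^sub>R (z - x))) +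
    (\<phi> (x - (1 / L) *\<^sub>R g) (z - (t / (2 * L)) *\<^sub>R g) - \<phi> x z) \<le> 0"
proof -
  have "t\<^sup>2 * f (x - (1 / L) *\<^sub>R g) \<le> t\<^sup>2 * (f x - (norm g)\<^sup>2 / (2 * L))"
    using L_smooth_gradient_step[OF assms(3,4), of x] by (intro mult_left_mono) (auto simp: g_def)
  moreover have "2 * t * (f x + g \<bullet> (p - x)) \<le> 2 * t * f p"
    using convex_on_gradient_le[OF assms(1,2), of p] assms(5) by (intro mult_left_mono) (auto simp: g_def)
  moreover have "2 * L * (norm (z - (t / (2 * L)) *\<^sub>R g - p))\<^sup>2 =
      2 * L * (norm (z - p))\<^sup>2 - 2 * t * (g \<bullet> (z - p)) + t\<^sup>2 * ((norm g)\<^sup>2 / (2 * L))"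
    unfolding norm_diff_scaleR_square using assms(4) by (simp add: field_simps power2_eq_square)
  \<comment> \<open>Both sides vanish at \<open>t = 0\<close>, so this case needs no separate
    treatment.\<close>
  moreover have "t\<^sup>2 * (g \<bullet> ((2 / t) *\<^sub>R (z - x))) = 2 * t * (g \<bullet> (z - x))"
    by (simp add: power2_eq_square)
  ultimately show ?thesis
    by (simp add: \<phi>_def inner_diff_right algebra_simps)
qed

text \<open>\<phi> omits the factor \<open>exp (a t)\<close>, whose derivative accounts for
  \<open>a * \<phi> x z\<close>. Once the jump is bounded, every term carries a factor
  \<open>a\<close>, and strong convexity bounds what it multiplies by
  \<open>- \<mu> / 2 * |x - z|^2\<close>.\<close>

lemma strong_generator_le:
  fixes f :: "'v::euclidean_space \<Rightarrow> real" and p x :: 'v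
  assumes "strongly_convex \<mu> f" "L_smooth L f" "L > 0" "\<mu> > 0"
  defines "g \<equiv> gradient f x" and "a \<equiv> sqrt (\<mu> / L)"
  defines "\<phi> \<equiv> \<lambda>x z. f x - f p + \<mu> / 2 * (norm (z - p))\<^sup>2"
  shows "a * \<phi> x z + g \<bullet> (a *\<^sub>R (z - x)) + \<mu> * ((z - p) \<bullet> (a *\<^sub>R (x - z))) +
    (\<phi> (x - (1 / L) *\<^sub>R g) (z - (1 / sqrt (\<mu> * L)) *\<^sub>R g) - \<phi> x z) \<le> 0"
proof -
  define b where "b = 1 / sqrt (\<mu> * L)"
  have a: "0 \<le> a" using assms by simp
  \<comment> \<open>The first identity lets the cross term of the jump of \<open>z\<close> match the
    drift; the second makes its \<open>|g|^2\<close> term cancel the decrease from the gradient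
    step.\<close>
  have b: "\<mu> * b = a" "\<mu> * b\<^sup>2 = 1 / L"
    using assms by (simp_all add: a_def b_def real_sqrt_divide real_sqrt_mult power_divide field_simps)
  have step: "f (x - (1 / L) *\<^sub>R g) \<le> f x - (1 / L) * (norm g)\<^sup>2 / 2"
    using L_smooth_gradient_step[OF assms(2,3), of x] by (simp add: g_def mult.commute)
  have "\<mu> / 2 * (norm (z - b *\<^sub>R g - p))\<^sup>2 =
      \<mu> / 2 * (norm (z - p))\<^sup>2 - (\<mu> * b) * (g \<bullet> (z - p)) + (\<mu> * b\<^sup>2) * (norm g)\<^sup>2 / 2"
    unfolding norm_diff_scaleR_square by (simp add: field_simps)
  note this[unfolded b]
  with step have jump: "\<phi> (x - (1 / L) *\<^sub>R g) (z - b *\<^sub>R g) - \<phi> x z \<le> - (a * (g \<bullet> (z - p)))"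
    unfolding \<phi>_def by linarith
  have "f x + g \<bullet> (p - x) + \<mu> / 2 * (norm (p - x))\<^sup>2 \<le> f p"
    using assms(1) by (simp add: strongly_convex_def g_def)
  \<comment> \<open>Expanding the square of \<open>x - p = (x - z) + (z - p)\<close> cancels the
    distances to \<open>p\<close>.\<close>
  moreover have "(norm (z - p))\<^sup>2 / 2 + (z - p) \<bullet> (x - z) - (norm (p - x))\<^sup>2 / 2 = - (norm (x - z))\<^sup>2 / 2"
    by (simp add: power2_norm_eq_inner inner_diff_left inner_diff_right inner_commute field_simps)
  then have "\<mu> * ((norm (z - p))\<^sup>2 / 2 + (z - p) \<bullet> (x - z) - (norm (p - x))\<^sup>2 / 2) \<le> 0"
    using assms(4) by (simp add: mult_le_0_iff)
  ultimately have "\<phi> x z + g \<bullet> (z - x) + \<mu> * ((z - p) \<bullet> (x - z)) - g \<bullet> (z - p) \<le> 0"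
    by (simp add: \<phi>_def inner_diff_right algebra_simps)
  then have "a * (\<phi> x z + g \<bullet> (z - x) + \<mu> * ((z - p) \<bullet> (x - z)) - g \<bullet> (z - p)) \<le> 0"
    using a by (simp add: mult_le_0_iff)
  with jump show ?thesis
    unfolding b_def[symmetric] by (simp add: algebra_simps)
qed

section \<open>Both convergence rates from the Lyapunov bounds\<close>

theorem theorem2:
  fixes f :: "real ^ 'd \<Rightarrow> real" and L :: real and x_star x0 z0 :: "real ^ 'd"
    and M :: "'w measure" and T :: "nat \<Rightarrow> 'w \<Rightarrow> real"
  assumes "prob_space M" and "poisson_times M T"
    and "convex_on UNIV f" and "\<forall>x. f differentiable (at x)"
    and "L > 0" and "L_smooth L f" and "\<forall>y. f x_star \<le> f y"
  shows
    "(\<forall>x z.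
        continuized_nesterov M T f (\<lambda>t. 2 / t) (\<lambda>t. 0) (\<lambda>t. 1 / L) (\<lambda>t. t / (2 * L)) x0 z0 x z \<longrightarrow>
        (\<forall>t>0. integrable M (\<lambda>\<omega>. f (x t \<omega>)) \<and>
          (\<integral>\<omega>. f (x t \<omega>) \<partial>M) - f x_star \<le> 2 * L * (norm (z0 - x_star))\<^sup>2 / t\<^sup>2)) \<and>
     (\<forall>\<mu> x z. \<mu> > 0 \<longrightarrow> strongly_convex \<mu> f \<longrightarrow>
        continuized_nesterov M T f (\<lambda>t. sqrt (\<mu> / L)) (\<lambda>t. sqrt (\<mu> / L))
          (\<lambda>t. 1 / L) (\<lambda>t. 1 / sqrt (\<mu> * L)) x0 z0 x z \<longrightarrow>
        (\<forall>t\<ge>0. integrable M (\<lambda>\<omega>. f (x t \<omega>)) \<and>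
          (\<integral>\<omega>. f (x t \<omega>) \<partial>M) - f x_star
            \<le> (f x0 - f x_star + \<mu> / 2 * (norm (z0 - x_star))\<^sup>2) * exp (- sqrt (\<mu> / L) * t)))"
proof -
  interpret prob_space M by fact
  note diff = assms(4)
  have min: "f x_star \<le> f y" for y using assms(7) by simp
  have "continuous_on UNIV f"
    using diff by (simp add: differentiable_imp_continuous_on differentiable_on_def differentiable_at_withinI)
  then have [measurable]: "f \<in> borel_measurable borel"
    by (rule borel_measurable_continuous_onI)
  note [measurable] = borel_measurable_gradient[OF diff]
  \<comment> \<open>Passes from a Lyapunov function to \<open>f\<close>: \<phi> dominates the
    weighted gap of \<open>f\<close> to its minimum, and \<open>A\<close> is the time weight to
    divide by.\<close>
  have bound: "integrable M (\<lambda>\<omega>. f (x \<omega>)) \<and> (\<integral>\<omega>. f (x \<omega>) \<partial>M) - f x_star \<le> B / A"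
    if [measurable]: "x \<in> borel_measurable M" and "0 < A" "0 \<le> B"
      and le: "(\<integral>\<^sup>+\<omega>. ennreal (\<phi> \<omega>) \<partial>M) \<le> ennreal B" "\<And>\<omega>. A * (f (x \<omega>) - f x_star) \<le> \<phi> \<omega>"
    for x \<phi> A B
  proof (rule integral_le_of_nn_integral_le)
    have "(\<integral>\<^sup>+\<omega>. ennreal (A * (f (x \<omega>) - f x_star)) \<partial>M) \<le> (\<integral>\<^sup>+\<omega>. ennreal (\<phi> \<omega>) \<partial>M)"
      by (intro nn_integral_mono ennreal_leI le(2))
    with le(1) show "(\<integral>\<^sup>+\<omega>. ennreal (A * (f (x \<omega>) - f x_star)) \<partial>M) \<le> ennreal B" by (rule order_trans[rotated])
  qed (use that min in auto)
  have part1: "integrable M (\<lambda>\<omega>. f (x t \<omega>)) \<and>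
      (\<integral>\<omega>. f (x t \<omega>) \<partial>M) - f x_star \<le> 2 * L * (norm (z0 - x_star))\<^sup>2 / t\<^sup>2"
    if nesterov: "continuized_nesterov M T f (\<lambda>t. 2 / t) (\<lambda>t. 0) (\<lambda>t. 1 / L) (\<lambda>t. t / (2 * L)) x0 z0 x z"
      and t: "0 < t" for x z t
  proof (rule bound)
    define \<phi> where "\<phi> t y = t\<^sup>2 * (f (fst y) - f x_star) + 2 * L * (norm (snd y - x_star))\<^sup>2"
      for t :: real and y :: "(real ^ 'd) \<times> (real ^ 'd)"
    define \<phi>' where "\<phi>' s t y = 2 * t * (f (fst (convex_flow s t y)) - f x_star) +
      t\<^sup>2 * (gradient f (fst (convex_flow s t y)) \<bullet>
        ((2 / t) *\<^sub>R (snd (convex_flow s t y) - fst (convex_flow s t y))))"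
      for s t :: real and y :: "(real ^ 'd) \<times> (real ^ 'd)"
    have "(\<integral>\<^sup>+\<omega>. ennreal (\<phi> t (x t \<omega>, z t \<omega>)) \<partial>M) \<le> ennreal (\<phi> 0 (x0, z0))"
    proof (rule continuized_nesterov_expected_lyapunov_le[OF assms(1,2) diff nesterov is_flow_convex_flow])
      show "(\<lambda>(s, t, y). convex_flow s t y :: (real ^ 'd) \<times> (real ^ 'd)) \<in> borel_measurable borel"
        unfolding convex_flow_def split_beta' borel_prod[symmetric] by measurable
      show "(\<lambda>(t, y). \<phi> t y) \<in> borel_measurable borel"
        unfolding \<phi>_def split_beta' borel_prod[symmetric] by measurable
      show "(\<lambda>(s, t, y). \<phi>' s t y) \<in> borel_measurable borel"
        unfolding \<phi>'_def convex_flow_def split_beta' borel_prod[symmetric] by simp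
      show "0 \<le> \<phi> t y" for t y
        unfolding \<phi>_def using assms(5) min[of "fst y"]
        by (intro add_nonneg_nonneg mult_nonneg_nonneg) auto
      show "((\<lambda>t. \<phi> t (convex_flow s t y)) has_real_derivative \<phi>' s t y) (at t)"
        if "0 < t \<or> 0 \<le> t \<and> s = 0" for s t y
      proof -
        have [simp]: "snd (convex_flow s t y) = snd y" for t by (simp add: convex_flow_def)
        have "((\<lambda>t. f (fst (convex_flow s t y))) has_real_derivative gradient f (fst (convex_flow s t y)) \<bullet>
            ((2 / t) *\<^sub>R (snd (convex_flow s t y) - fst (convex_flow s t y)))) (at t)"
          by (rule gradient_derivative[OF diff[rule_format] convex_flow_derivative]) (use that in auto)
        then show ?thesis
          unfolding \<phi>_def \<phi>'_def by (auto intro!: derivative_eq_intros)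
      qed
      show "\<phi>' s t y + (\<phi> t (jump f (\<lambda>t. 1 / L) (\<lambda>t. t / (2 * L)) t (convex_flow s t y)) - \<phi> t (convex_flow s t y)) \<le> 0"
        if "0 \<le> s" "s \<le> t" for s t y
        using convex_generator_le[OF assms(3) diff[rule_format] assms(6,5), of t "fst (convex_flow s t y)" x_star "snd (convex_flow s t y)"]
          that
        by (simp add: \<phi>_def \<phi>'_def jump_def)
      \<comment> \<open>At \<open>s = 0\<close> the flow replaces the first component by the second,
        but \<phi> gives the first one weight \<open>0\<close> there.\<close>
      show "\<phi> s (convex_flow s s y) = \<phi> s y" if "0 \<le> s" for s y
        using that by (cases "s = 0") (simp_all add: \<phi>_def convex_flow_def)
    qed (use t in auto)
    \<comment> \<open>The weight \<open>0\<close> at the start also removes \<open>x0\<close>, so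
      the bound involves \<open>z0\<close> only.\<close>
    then show "(\<integral>\<^sup>+\<omega>. ennreal (\<phi> t (x t \<omega>, z t \<omega>)) \<partial>M) \<le> ennreal (2 * L * (norm (z0 - x_star))\<^sup>2)"
      by (simp add: \<phi>_def)
    show "t\<^sup>2 * (f (x t \<omega>) - f x_star) \<le> \<phi> t (x t \<omega>, z t \<omega>)" for \<omega>
      using assms(5) by (simp add: \<phi>_def)
    show "x t \<in> borel_measurable M"
      using nesterov t by (simp add: continuized_nesterov_def)
  qed (use t assms(5) in auto)
  have part2: "integrable M (\<lambda>\<omega>. f (x t \<omega>)) \<and>
      (\<integral>\<omega>. f (x t \<omega>) \<partial>M) - f x_star
        \<le> (f x0 - f x_star + \<mu> / 2 * (norm (z0 - x_star))\<^sup>2) / exp (sqrt (\<mu> / L) * t)"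
    if \<mu>: "\<mu> > 0" "strongly_convex \<mu> f"
      and nesterov: "continuized_nesterov M T f (\<lambda>t. sqrt (\<mu> / L)) (\<lambda>t. sqrt (\<mu> / L))
          (\<lambda>t. 1 / L) (\<lambda>t. 1 / sqrt (\<mu> * L)) x0 z0 x z"
      and t: "0 \<le> t" for \<mu> x z t
  proof (rule bound)
    define a where "a = sqrt (\<mu> / L)"
    define V where "V y = f (fst y) - f x_star + \<mu> / 2 * (norm (snd y - x_star))\<^sup>2" for y :: "(real ^ 'd) \<times> (real ^ 'd)"
    define \<phi> where "\<phi> t y = exp (a * t) * V y" for t y
    define \<phi>' where "\<phi>' s t y = exp (a * t) * (a * V (strong_flow a s t y) +
      gradient f (fst (strong_flow a s t y)) \<bullet>
        (a *\<^sub>R (snd (strong_flow a s t y) - fst (strong_flow a s t y))) +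
      \<mu> * ((snd (strong_flow a s t y) - x_star) \<bullet>
        (a *\<^sub>R (fst (strong_flow a s t y) - snd (strong_flow a s t y)))))"
      for s t :: real and y :: "(real ^ 'd) \<times> (real ^ 'd)"
    have V: "0 \<le> V y" for y
      using \<mu>(1) min by (simp add: V_def)
    have "(\<integral>\<^sup>+\<omega>. ennreal (\<phi> t (x t \<omega>, z t \<omega>)) \<partial>M) \<le> ennreal (\<phi> 0 (x0, z0))"
    proof (rule continuized_nesterov_expected_lyapunov_le[OF assms(1,2) diff nesterov is_flow_strong_flow, folded a_def])
      show "(\<lambda>(s, t, y). strong_flow a s t y :: (real ^ 'd) \<times> (real ^ 'd)) \<in> borel_measurable borel"
        unfolding strong_flow_def split_beta' borel_prod[symmetric] by measurable
      show "(\<lambda>(t, y). \<phi> t y) \<in> borel_measurable borel"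
        unfolding \<phi>_def V_def split_beta' borel_prod[symmetric] by measurable
      show "(\<lambda>(s, t, y). \<phi>' s t y) \<in> borel_measurable borel"
        unfolding \<phi>'_def V_def strong_flow_def split_beta' borel_prod[symmetric] by simp
      show "0 \<le> \<phi> t y" for t y
        using V by (simp add: \<phi>_def)
      show "((\<lambda>t. \<phi> t (strong_flow a s t y)) has_real_derivative \<phi>' s t y) (at t)" for s t y
      proof -
        have x: "((\<lambda>t. f (fst (strong_flow a s t y))) has_real_derivative gradient f (fst (strong_flow a s t y)) \<bullet>
            (a *\<^sub>R (snd (strong_flow a s t y) - fst (strong_flow a s t y)))) (at t)"
          by (rule gradient_derivative[OF diff[rule_format] strong_flow_derivative(1)])
        have z: "((\<lambda>t. (norm (snd (strong_flow a s t y) - x_star))\<^sup>2) has_real_derivative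
            2 * ((snd (strong_flow a s t y) - x_star) \<bullet>
              (a *\<^sub>R (fst (strong_flow a s t y) - snd (strong_flow a s t y))))) (at t)"
        proof -
          have d: "((\<lambda>t. snd (strong_flow a s t y) - x_star) has_vector_derivative
              a *\<^sub>R (fst (strong_flow a s t y) - snd (strong_flow a s t y))) (at t)"
            using has_vector_derivative_diff[OF strong_flow_derivative(2) has_vector_derivative_const[of x_star]] by simp
          show ?thesis
            using bounded_bilinear.has_vector_derivative[OF bounded_bilinear_inner d d]
            by (simp add: power2_norm_eq_inner has_real_derivative_iff_has_vector_derivative inner_commute)
        qed
        show ?thesis
          unfolding \<phi>_def \<phi>'_def V_def
          by (rule derivative_eq_intros x z refl | simp add: algebra_simps)+
      qed
      show "\<phi>' s t y + (\<phi> t (jump f (\<lambda>t. 1 / L) (\<lambda>t. 1 / sqrt (\<mu> * L)) t (strong_flow a s t y)) - \<phi> t (strong_flow a s t y)) \<le> 0"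
        if "0 \<le> s" "s \<le> t" for s t y
      proof -
        \<comment> \<open>The exponential factors out of drift and jump alike, leaving the
          time-independent inequality for \<open>V\<close>.\<close>
        have "exp (a * t) * (a * V (strong_flow a s t y) +
            gradient f (fst (strong_flow a s t y)) \<bullet> (a *\<^sub>R (snd (strong_flow a s t y) - fst (strong_flow a s t y))) +
            \<mu> * ((snd (strong_flow a s t y) - x_star) \<bullet> (a *\<^sub>R (fst (strong_flow a s t y) - snd (strong_flow a s t y)))) +
            (V (jump f (\<lambda>t. 1 / L) (\<lambda>t. 1 / sqrt (\<mu> * L)) t (strong_flow a s t y)) - V (strong_flow a s t y))) \<le> 0"
          unfolding V_def jump_def fst_conv snd_conv a_def
          by (rule mult_nonneg_nonpos[OF exp_ge_zero strong_generator_le[OF \<mu>(2) assms(6,5) \<mu>(1)]])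
        then show ?thesis
          by (simp add: \<phi>_def \<phi>'_def algebra_simps)
      qed
      show "\<phi> s (strong_flow a s s y) = \<phi> s y" for s y
        by (simp add: strong_flow_def flip: scaleR_2)
      show "0 < t \<or> t = 0 \<and> strong_flow a 0 0 (x0, z0) = (x0, z0)"
        using t by (auto simp: strong_flow_def simp flip: scaleR_2)
    qed auto
    then show "(\<integral>\<^sup>+\<omega>. ennreal (\<phi> t (x t \<omega>, z t \<omega>)) \<partial>M) \<le>
        ennreal (f x0 - f x_star + \<mu> / 2 * (norm (z0 - x_star))\<^sup>2)"
      by (simp add: \<phi>_def V_def)
    show "exp (sqrt (\<mu> / L) * t) * (f (x t \<omega>) - f x_star) \<le> \<phi> t (x t \<omega>, z t \<omega>)" for \<omega>
      using \<mu>(1) by (simp add: \<phi>_def V_def a_def)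
    show "x t \<in> borel_measurable M"
      using nesterov t by (simp add: continuized_nesterov_def)
    show "0 \<le> f x0 - f x_star + \<mu> / 2 * (norm (z0 - x_star))\<^sup>2"
      using V[of "(x0, z0)"] by (simp add: V_def)
  qed simp
  have "c * exp (- sqrt (\<mu> / L) * t) = c / exp (sqrt (\<mu> / L) * t)" for c \<mu> t
    by (simp add: exp_minus divide_inverse)
  with part1 part2 show ?thesis by presburger
qed

end
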